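(* Let $\mathcal{C}$ be a full subcategory of rings which is closed under ultraproducts. Then every ring in $\mathcal{C}^+$ is geometrically closed in $\mathcal{C}^+$.
   Context: All rings are commutative and unitary. For a ring homomorphism $f:A\to B$, a finite set $X$ of variables and an ideal $I$ of $A[X]$, $\mathcal{Z}_f(I)\subseteq B^X$ is the set of zeros of $I$ in $B^X$ through $f$, and $\mathcal{Z}(I)=\mathcal{Z}_{\mathrm{id}_A}(I)\subseteq A^X$; for $E\subseteq A^X$, $\mathcal{I}(E)\subseteq A[X]$ is the ideal of polynomials vanishing on $E$. A homomorphism $f:A\to B$ is existentially closed if for every finite $X$ and every finitely generated ideal $I$ of $A[X]$ with $\mathcal{Z}_f(I)\neq\emptyset$, one has $\mathcal{Z}(I)\neq\emptyset$. A ring $A$ is existentially closed in $\mathcal{C}$ if $A$ is in $\mathcal{C}$ and every homomorphism $A\to B$ with $B$ in $\mathcal{C}$ is existentially closed; $\mathcal{C}^+$ is the full subcategory of the rings existentially closed in $\mathcal{C}$. For a full subcategory $\mathcal{D}$ of rings, an ideal $J$ of a ring $R$ is $\mathcal{D}$-prime if $R/J$ embeds into a ring of $\mathcal{D}$, and the $\mathcal{D}$-radical $\sqrt[\mathcal{D}]{J}$ is the intersection of all $\mathcal{D}$-prime ideals of $R$ containing $J$ (equal to $R$ if there is none). A ring $A$ is geometrically closed in $\mathcal{D}$ if $A$ is in $\mathcal{D}$ and for every finite $X$ and every finitely generated ideal $I$ of $A[X]$, $\mathcal{I}(\mathcal{Z}(I))=\sqrt[\mathcal{D}]{I}$. *)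

theory Defs
  imports
    "HOL-Algebra.Algebra"
    "HOL-Library.Multiset"
    "HOL-Library.Equipollence"
begin

section \<open>Polynomials in a set of variables over a ring\<close>

text \<open>
  Monomials are multisets of variables, and a polynomial is its finitely supported
  coefficient function.
\<close>

definition mpoly_ring :: "('a, 'm) ring_scheme \<Rightarrow> 'v set \<Rightarrow> ('v multiset \<Rightarrow> 'a) ring"
  where "mpoly_ring A V =
    \<lparr> carrier = {p. (\<forall>m. p m \<in> carrier A) \<and> finite {m. p m \<noteq> \<zero>\<^bsub>A\<^esub>} \<and>
                    (\<forall>m. p m \<noteq> \<zero>\<^bsub>A\<^esub> \<longrightarrow> set_mset m \<subseteq> V)},
      monoid.mult = (\<lambda>p q m. \<Oplus>\<^bsub>A\<^esub>n\<in>{n. n \<subseteq># m}. p n \<otimes>\<^bsub>A\<^esub> q (m - n)),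
      monoid.one = (\<lambda>m. if m = {#} then \<one>\<^bsub>A\<^esub> else \<zero>\<^bsub>A\<^esub>),
      ring.zero = (\<lambda>m. \<zero>\<^bsub>A\<^esub>),
      ring.add = (\<lambda>p q m. p m \<oplus>\<^bsub>A\<^esub> q m) \<rparr>"

text \<open>The value at the point \<open>b\<close> of the image of the polynomial \<open>p\<close> under \<open>f\<close>.\<close>

definition mpoly_eval ::
  "('a, 'm) ring_scheme \<Rightarrow> ('b, 'n) ring_scheme \<Rightarrow> ('a \<Rightarrow> 'b) \<Rightarrow> ('v \<Rightarrow> 'b) \<Rightarrow> ('v multiset \<Rightarrow> 'a) \<Rightarrow> 'b"
  where "mpoly_eval A B f b p =
    (\<Oplus>\<^bsub>B\<^esub>m\<in>{m. p m \<noteq> \<zero>\<^bsub>A\<^esub>}. f (p m) \<otimes>\<^bsub>B\<^esub> (\<Otimes>\<^bsub>B\<^esub>i\<in>set_mset m. b i [^]\<^bsub>B\<^esub> count m i))"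

definition zero_set ::
  "('a, 'm) ring_scheme \<Rightarrow> ('b, 'n) ring_scheme \<Rightarrow> ('a \<Rightarrow> 'b) \<Rightarrow> 'v set \<Rightarrow> ('v multiset \<Rightarrow> 'a) set \<Rightarrow> ('v \<Rightarrow> 'b) set"
  where "zero_set A B f V I =
    {b \<in> V \<rightarrow>\<^sub>E carrier B. \<forall>p\<in>I. mpoly_eval A B f b p = \<zero>\<^bsub>B\<^esub>}"

definition vanishing_ideal ::
  "('a, 'm) ring_scheme \<Rightarrow> 'v set \<Rightarrow> ('v \<Rightarrow> 'a) set \<Rightarrow> ('v multiset \<Rightarrow> 'a) set"
  where "vanishing_ideal A V E =
    {p \<in> carrier (mpoly_ring A V). \<forall>a\<in>E. mpoly_eval A A id a p = \<zero>\<^bsub>A\<^esub>}"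

definition fg_ideal :: "'a set \<Rightarrow> ('a, 'm) ring_scheme \<Rightarrow> bool"
  where "fg_ideal I R \<longleftrightarrow> (\<exists>S. finite S \<and> S \<subseteq> carrier R \<and> I = Idl\<^bsub>R\<^esub> S)"


section \<open>Full subcategories of rings and ultraproducts\<close>

text \<open>
  HOL has no type of all rings, so the type \<open>'u\<close> plays the role of the universe of sets: the
  rings are the commutative rings whose carrier is a small subset of \<open>'u\<close>, and small means of
  cardinality less than that of \<open>'u\<close>. When the cardinality of \<open>'u\<close> is inaccessible, this is the
  category of rings of the corresponding Grothendieck universe. A full subcategory is given by
  its objects; it need not be closed under isomorphism.
\<close>

definition full_subcategory :: "'u ring set \<Rightarrow> bool"
  where "full_subcategory C \<longleftrightarrow> (\<forall>R\<in>C. cring R \<and> carrier R \<prec> (UNIV :: 'u set))"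

text \<open>An ultrafilter on the set \<open>I\<close>, as a filter on the whole type that contains \<open>I\<close>.\<close>

definition ultrafilter_on :: "'i set \<Rightarrow> 'i filter \<Rightarrow> bool"
  where "ultrafilter_on I U \<longleftrightarrow> U \<noteq> bot \<and> (\<forall>\<^sub>F i in U. i \<in> I) \<and>
    (\<forall>P. (\<forall>\<^sub>F i in U. P i) \<or> (\<forall>\<^sub>F i in U. \<not> P i))"

definition product_ring :: "'i set \<Rightarrow> ('i \<Rightarrow> ('a, 'm) ring_scheme) \<Rightarrow> ('i \<Rightarrow> 'a) ring"
  where "product_ring I R =
    \<lparr> carrier = (\<Pi>\<^sub>E i\<in>I. carrier (R i)),
      monoid.mult = (\<lambda>x y. \<lambda>i\<in>I. x i \<otimes>\<^bsub>R i\<^esub> y i),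
      monoid.one = (\<lambda>i\<in>I. \<one>\<^bsub>R i\<^esub>),
      ring.zero = (\<lambda>i\<in>I. \<zero>\<^bsub>R i\<^esub>),
      ring.add = (\<lambda>x y. \<lambda>i\<in>I. x i \<oplus>\<^bsub>R i\<^esub> y i) \<rparr>"

text \<open>
  Two families are congruent modulo the ideal below iff they agree on a set in \<open>U\<close>.
\<close>

definition ultraproduct ::
  "'i set \<Rightarrow> 'i filter \<Rightarrow> ('i \<Rightarrow> ('a, 'm) ring_scheme) \<Rightarrow> ('i \<Rightarrow> 'a) set ring"
  where "ultraproduct I U R =
    product_ring I R Quot {x \<in> carrier (product_ring I R). \<forall>\<^sub>F i in U. x i = \<zero>\<^bsub>R i\<^esub>}"

text \<open>
  Index sets are small. The elements of an ultraproduct are not of type \<open>'u\<close>, hence the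
  isomorphic copy.
\<close>

definition closed_under_ultraproducts :: "'u ring set \<Rightarrow> bool"
  where "closed_under_ultraproducts C \<longleftrightarrow>
    (\<forall>(I :: 'u set) U R. I \<prec> (UNIV :: 'u set) \<longrightarrow> ultrafilter_on I U \<longrightarrow> (\<forall>i\<in>I. R i \<in> C) \<longrightarrow>
      (\<exists>S\<in>C. ultraproduct I U R \<simeq> S))"


section \<open>Existentially closed and geometrically closed rings\<close>

text \<open>Finite sets of variables are taken among the natural numbers.\<close>

definition existentially_closed_hom ::
  "('a, 'm) ring_scheme \<Rightarrow> ('b, 'n) ring_scheme \<Rightarrow> ('a \<Rightarrow> 'b) \<Rightarrow> bool"
  where "existentially_closed_hom A B f \<longleftrightarrow>
    (\<forall>(V :: nat set) I. finite V \<longrightarrow> fg_ideal I (mpoly_ring A V) \<longrightarrow>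
      zero_set A B f V I \<noteq> {} \<longrightarrow> zero_set A A id V I \<noteq> {})"

definition existentially_closed_in :: "'u ring set \<Rightarrow> 'u ring \<Rightarrow> bool"
  where "existentially_closed_in C A \<longleftrightarrow>
    A \<in> C \<and> (\<forall>B\<in>C. \<forall>f\<in>ring_hom A B. existentially_closed_hom A B f)"

definition ec_subcategory :: "'u ring set \<Rightarrow> 'u ring set"
  where "ec_subcategory C = {A. existentially_closed_in C A}"

definition prime_wrt :: "'u ring set \<Rightarrow> 'a set \<Rightarrow> ('a, 'm) ring_scheme \<Rightarrow> bool"
  where "prime_wrt D J R \<longleftrightarrow> ideal J R \<and>
    (\<exists>S\<in>D. \<exists>h\<in>ring_hom (R Quot J) S. inj_on h (carrier (R Quot J)))"

definition radical_wrt :: "'u ring set \<Rightarrow> 'a set \<Rightarrow> ('a, 'm) ring_scheme \<Rightarrow> 'a set"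
  where "radical_wrt D J R = carrier R \<inter> \<Inter>{P. prime_wrt D P R \<and> J \<subseteq> P}"

definition geometrically_closed_in :: "'u ring set \<Rightarrow> 'u ring \<Rightarrow> bool"
  where "geometrically_closed_in D A \<longleftrightarrow> A \<in> D \<and>
    (\<forall>(V :: nat set) I. finite V \<longrightarrow> fg_ideal I (mpoly_ring A V) \<longrightarrow>
      vanishing_ideal A V (zero_set A A id V I) = radical_wrt D I (mpoly_ring A V))"

end

theory Submission
  imports Defs
begin

text \<open>
  Evaluation at a zero of \<open>I\<close> has a \<open>C\<^sup>+\<close>-prime kernel, so the radical of \<open>I\<close> vanishes on the zero
  set. Conversely, an embedding of \<open>A[V]/Q\<close> with \<open>I \<subseteq> Q\<close> into some \<open>B\<close> in \<open>C\<^sup>+\<close> is a homomorphism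
  \<open>f : A \<rightarrow> B\<close> with a zero \<open>b\<close> of \<open>I\<close> in \<open>B\<close>. Let \<open>p\<close> vanish on the zeros of \<open>I\<close> in \<open>A\<close>; the
  inequation \<open>p(b) \<noteq> 0\<close> is not a system of equations, but since \<open>B\<close> is existentially closed, it
  suffices to find a homomorphism from \<open>B\<close> to a ring of \<open>C\<close> that kills \<open>p(b)\<close>. Every finite part of
  the diagram of \<open>B\<close>, together with \<open>I\<close> and the value of \<open>p\<close>, is solvable in \<open>B\<close>, hence in \<open>A\<close>, where
  \<open>p\<close> then takes the value \<open>0\<close>. These solutions are partial homomorphisms from \<open>B\<close> to \<open>A\<close> that kill
  \<open>p(b)\<close>, and they assemble to a homomorphism into an ultrapower of \<open>A\<close>.
\<close>


section \<open>The polynomial ring\<close>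

text \<open>The index set \<open>Sigma I A\<close> is the disjoint union of its slices over the
  elements of \<open>I\<close>. In additive form this regroups the double sums that come from
  products of polynomials.\<close>

lemma (in comm_monoid) finprod_Sigma:
  assumes "finite I" "\<And>i. i \<in> I \<Longrightarrow> finite (A i)"
    and "\<And>i x. i \<in> I \<Longrightarrow> x \<in> A i \<Longrightarrow> g i x \<in> carrier G"
  shows "(\<Otimes>i\<in>I. \<Otimes>x\<in>A i. g i x) = (\<Otimes>z\<in>Sigma I A. g (fst z) (snd z))"
proof -
  have "(\<Otimes>z\<in>Sigma I A. g (fst z) (snd z)) =
      finprod G (\<lambda>z. g (fst z) (snd z)) (\<Union>i\<in>I. Pair i ` A i)"
    by (rule arg_cong[where f = "finprod G _"]) auto
  also have "\<dots> = (\<Otimes>i\<in>I. finprod G (\<lambda>z. g (fst z) (snd z)) (Pair i ` A i))"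
    using assms by (intro finprod_UN_disjoint) (auto simp: pairwise_def disjnt_def)
  also have "\<dots> = (\<Otimes>i\<in>I. \<Otimes>x\<in>A i. g i x)"
  proof (rule finprod_cong')
    fix i assume i: "i \<in> I"
    show "finprod G (\<lambda>z. g (fst z) (snd z)) (Pair i ` A i) = (\<Otimes>x\<in>A i. g i x)"
      using assms(3)[OF i] by (subst finprod_reindex) (auto intro: inj_onI)
  qed (use assms in \<open>auto intro!: finprod_closed\<close>)
  finally show ?thesis by simp
qed

text \<open>A submultiset of \<open>add_mset x m\<close> either contains \<open>x\<close>, and
  removing one copy leaves a submultiset of \<open>m\<close>, or it lies below \<open>m\<close>
  already. Finiteness makes the convolution a genuine sum, to which distributivity and regrouping
  apply.\<close>

lemma finite_subset_mset: "finite {n. n \<subseteq># (m :: 'v multiset)}"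
proof (induction m)
  case (add x m)
  have "n \<in> {n. n \<subseteq># m} \<union> add_mset x ` {n. n \<subseteq># m}" if "n \<subseteq># add_mset x m" for n
  proof (cases "x \<in># n")
    case True
    then obtain k where "n = add_mset x k" by (metis insert_DiffM)
    with that show ?thesis by auto
  next
    case False
    then have "n = n - {#x#}" by simp
    moreover have "n - {#x#} \<subseteq># m"
      using that by (simp add: subset_eq_diff_conv)
    ultimately show ?thesis by simp
  qed
  then have "{n. n \<subseteq># add_mset x m} \<subseteq> {n. n \<subseteq># m} \<union> add_mset x ` {n. n \<subseteq># m}" by blast
  with add show ?case by (meson finite_UnI finite_imageI finite_subset)
qed auto

lemma diff_diff_subset_mset: "n \<subseteq># m \<Longrightarrow> m - (m - n) = n"
  by (simp add: multiset_eq_iff subseteq_mset_def)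

section \<open>Coefficients, supports and the convolution product\<close>

lemma mpoly_ring_simps [simp]:
  "\<one>\<^bsub>mpoly_ring R V\<^esub> = (\<lambda>m. if m = {#} then \<one>\<^bsub>R\<^esub> else \<zero>\<^bsub>R\<^esub>)"
  "\<zero>\<^bsub>mpoly_ring R V\<^esub> = (\<lambda>m. \<zero>\<^bsub>R\<^esub>)"
  "p \<oplus>\<^bsub>mpoly_ring R V\<^esub> q = (\<lambda>m. p m \<oplus>\<^bsub>R\<^esub> q m)"
  by (simp_all add: mpoly_ring_def)

lemma mpoly_mult:
  "(p \<otimes>\<^bsub>mpoly_ring R V\<^esub> q) m = (\<Oplus>\<^bsub>R\<^esub>n\<in>{n. n \<subseteq># m}. p n \<otimes>\<^bsub>R\<^esub> q (m - n))"
  by (simp add: mpoly_ring_def)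

lemma mpoly_carrier_iff:
  "p \<in> carrier (mpoly_ring R V) \<longleftrightarrow> (\<forall>m. p m \<in> carrier R) \<and> finite {m. p m \<noteq> \<zero>\<^bsub>R\<^esub>} \<and>
    (\<forall>m. p m \<noteq> \<zero>\<^bsub>R\<^esub> \<longrightarrow> set_mset m \<subseteq> V)"
  by (simp add: mpoly_ring_def)

lemma mpoly_coeff_closed [simp, intro]: "p \<in> carrier (mpoly_ring R V) \<Longrightarrow> p m \<in> carrier R"
  by (simp add: mpoly_carrier_iff)

lemma mpoly_finite_support: "p \<in> carrier (mpoly_ring R V) \<Longrightarrow> finite {m. p m \<noteq> \<zero>\<^bsub>R\<^esub>}"
  by (simp add: mpoly_carrier_iff)

lemma mpoly_support_vars:
  "p \<in> carrier (mpoly_ring R V) \<Longrightarrow> p m \<noteq> \<zero>\<^bsub>R\<^esub> \<Longrightarrow> set_mset m \<subseteq> V"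
  by (simp add: mpoly_carrier_iff)

lemma mpoly_carrier_mono:
  "V \<subseteq> W \<Longrightarrow> carrier (mpoly_ring R V) \<subseteq> carrier (mpoly_ring R W)"
  by (fastforce simp: mpoly_carrier_iff)

context cring
begin

lemma mpoly_add_closed:
  assumes "p \<in> carrier (mpoly_ring R V)" "q \<in> carrier (mpoly_ring R V)"
  shows "p \<oplus>\<^bsub>mpoly_ring R V\<^esub> q \<in> carrier (mpoly_ring R V)"
proof -
  have "{m. p m \<oplus> q m \<noteq> \<zero>} \<subseteq> {m. p m \<noteq> \<zero>} \<union> {m. q m \<noteq> \<zero>}"
    by auto
  then have "finite {m. p m \<oplus> q m \<noteq> \<zero>}"
    by (rule finite_subset) (use assms in \<open>auto intro: mpoly_finite_support\<close>)
  moreover have "set_mset m \<subseteq> V" if "p m \<oplus> q m \<noteq> \<zero>" for m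
    using that assms[THEN mpoly_support_vars, of m] by fastforce
  ultimately show ?thesis
    using assms by (simp add: mpoly_carrier_iff)
qed

text \<open>A nonzero coefficient at \<open>m\<close> needs a nonzero summand, that is, a splitting
  of \<open>m\<close> into a monomial of \<open>p\<close> and a monomial of \<open>q\<close>. Zero
  divisors and cancellation can make the inclusion strict.\<close>

lemma mpoly_mult_support:
  assumes "p \<in> carrier (mpoly_ring R V)" "q \<in> carrier (mpoly_ring R V)"
  shows "{m. (p \<otimes>\<^bsub>mpoly_ring R V\<^esub> q) m \<noteq> \<zero>} \<subseteq>
    (\<lambda>(n, k). n + k) ` ({m. p m \<noteq> \<zero>} \<times> {m. q m \<noteq> \<zero>})"
proof
  fix m assume m: "m \<in> {m. (p \<otimes>\<^bsub>mpoly_ring R V\<^esub> q) m \<noteq> \<zero>}"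
  have "\<exists>n. n \<subseteq># m \<and> p n \<otimes> q (m - n) \<noteq> \<zero>"
  proof (rule ccontr)
    assume "\<not> ?thesis"
    then have "(p \<otimes>\<^bsub>mpoly_ring R V\<^esub> q) m = \<zero>"
      unfolding mpoly_mult by (intro add.finprod_one_eqI) auto
    with m show False by simp
  qed
  then obtain n where n: "n \<subseteq># m" "p n \<otimes> q (m - n) \<noteq> \<zero>" by blast
  then have "p n \<noteq> \<zero>" "q (m - n) \<noteq> \<zero>"
    using assms by (metis l_null r_null mpoly_coeff_closed)+
  with n show "m \<in> (\<lambda>(n, k). n + k) ` ({m. p m \<noteq> \<zero>} \<times> {m. q m \<noteq> \<zero>})"
    by (intro image_eqI[of _ _ "(n, m - n)"]) auto
qed

lemma mpoly_mult_closed: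
  assumes "p \<in> carrier (mpoly_ring R V)" "q \<in> carrier (mpoly_ring R V)"
  shows "p \<otimes>\<^bsub>mpoly_ring R V\<^esub> q \<in> carrier (mpoly_ring R V)"
proof -
  have "finite {m. (p \<otimes>\<^bsub>mpoly_ring R V\<^esub> q) m \<noteq> \<zero>}"
    using assms by (intro finite_subset[OF mpoly_mult_support] finite_imageI finite_cartesian_product)
      (auto intro: mpoly_finite_support)
  moreover have "set_mset m \<subseteq> V" if "(p \<otimes>\<^bsub>mpoly_ring R V\<^esub> q) m \<noteq> \<zero>" for m
  proof -
    have "m \<in> (\<lambda>(n, k). n + k) ` ({m. p m \<noteq> \<zero>} \<times> {m. q m \<noteq> \<zero>})"
      using mpoly_mult_support[OF assms] that by blast
    then show ?thesis
      using assms[THEN mpoly_support_vars] by fastforce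
  qed
  moreover have "(p \<otimes>\<^bsub>mpoly_ring R V\<^esub> q) m \<in> carrier R" for m
    using assms unfolding mpoly_mult by (intro finsum_closed) auto
  ultimately show ?thesis
    unfolding mpoly_carrier_iff by blast
qed

text \<open>In the coefficient at \<open>m\<close>, the involution \<open>\<lambda>n. m - n\<close>
  on the submultisets of \<open>m\<close> exchanges the roles of the two factors.\<close>

lemma mpoly_m_comm:
  fixes p q :: "'v multiset \<Rightarrow> 'a"
  assumes "p \<in> carrier (mpoly_ring R V)" "q \<in> carrier (mpoly_ring R V)"
  shows "p \<otimes>\<^bsub>mpoly_ring R V\<^esub> q = q \<otimes>\<^bsub>mpoly_ring R V\<^esub> p"
proof
  fix m :: "'v multiset"
  have "bij_betw (\<lambda>n. m - n) {n. n \<subseteq># m} {n. n \<subseteq># m}"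
    by (rule bij_betw_byWitness[where f' = "\<lambda>n. m - n"]) (auto simp: diff_diff_subset_mset)
  then have inj: "inj_on (\<lambda>n. m - n) {n. n \<subseteq># m}"
    and img: "(\<lambda>n. m - n) ` {n. n \<subseteq># m} = {n. n \<subseteq># m}"
    by (auto simp: bij_betw_def)
  have "(p \<otimes>\<^bsub>mpoly_ring R V\<^esub> q) m = (\<Oplus>n\<in>(\<lambda>n. m - n) ` {n. n \<subseteq># m}. p n \<otimes> q (m - n))"
    by (simp add: mpoly_mult img)
  also have "\<dots> = (\<Oplus>n\<in>{n. n \<subseteq># m}. p (m - n) \<otimes> q (m - (m - n)))"
    using assms by (intro finsum_reindex inj) auto
  also have "\<dots> = (q \<otimes>\<^bsub>mpoly_ring R V\<^esub> p) m"
    unfolding mpoly_mult using assms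
    by (intro finsum_cong') (auto simp: diff_diff_subset_mset m_comm)
  finally show "(p \<otimes>\<^bsub>mpoly_ring R V\<^esub> q) m = (q \<otimes>\<^bsub>mpoly_ring R V\<^esub> p) m" .
qed

text \<open>Both coefficients at \<open>m\<close> are sums of
  \<open>p k \<otimes> q l \<otimes> r (m - k - l)\<close>. The left side lists the pairs as
  \<open>(k + l, k)\<close> in \<open>S\<close>, the right side as \<open>(k, l)\<close> in
  \<open>T\<close>, and \<open>h\<close> translates between the two lists.\<close>

lemma mpoly_m_assoc:
  fixes p q r :: "'v multiset \<Rightarrow> 'a"
  assumes "p \<in> carrier (mpoly_ring R V)" "q \<in> carrier (mpoly_ring R V)"
    "r \<in> carrier (mpoly_ring R V)"
  shows "(p \<otimes>\<^bsub>mpoly_ring R V\<^esub> q) \<otimes>\<^bsub>mpoly_ring R V\<^esub> r =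
    p \<otimes>\<^bsub>mpoly_ring R V\<^esub> (q \<otimes>\<^bsub>mpoly_ring R V\<^esub> r)"
proof
  fix m :: "'v multiset"
  define S where "S = (SIGMA n:{n. n \<subseteq># m}. {k. k \<subseteq># n})"
  define T where "T = (SIGMA k:{k. k \<subseteq># m}. {l. l \<subseteq># m - k})"
  define h where "h = (\<lambda>(k :: 'v multiset, l). (k + l, k))"
  have hT: "h ` T = S"
  proof
    show "h ` T \<subseteq> S"
    proof (clarsimp simp: h_def T_def S_def)
      fix k l assume "k \<subseteq># m" "l \<subseteq># m - k"
      then show "k + l \<subseteq># m"
        by (metis mset_subset_eq_mono_add_left_cancel subset_mset.add_diff_inverse)
    qed
    show "S \<subseteq> h ` T"
    proof (clarsimp simp: S_def)
      fix n k assume "n \<subseteq># m" "k \<subseteq># n"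
      then have "k \<subseteq># m" "n - k \<subseteq># m - k" "k + (n - k) = n"
        by (auto simp: subseteq_mset_def multiset_eq_iff diff_le_mono intro: le_trans)
      then show "(n, k) \<in> h ` T"
        by (intro image_eqI[of _ _ "(k, n - k)"]) (auto simp: h_def T_def)
    qed
  qed
  have inj: "inj_on h T"
    by (auto simp: h_def inj_on_def)
  have "((p \<otimes>\<^bsub>mpoly_ring R V\<^esub> q) \<otimes>\<^bsub>mpoly_ring R V\<^esub> r) m =
      (\<Oplus>n\<in>{n. n \<subseteq># m}. \<Oplus>k\<in>{k. k \<subseteq># n}. p k \<otimes> q (n - k) \<otimes> r (m - n))"
    unfolding mpoly_mult using assms
    by (intro finsum_cong' refl) (auto intro!: finsum_ldistr finsum_closed simp: finite_subset_mset)
  also have "\<dots> = (\<Oplus>z\<in>S. p (snd z) \<otimes> q (fst z - snd z) \<otimes> r (m - fst z))"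
    unfolding S_def using assms by (intro add.finprod_Sigma) (auto simp: finite_subset_mset)
  also have "\<dots> = (\<Oplus>z\<in>T. p (snd (h z)) \<otimes> q (fst (h z) - snd (h z)) \<otimes> r (m - fst (h z)))"
    unfolding hT[symmetric] using assms by (intro finsum_reindex inj) auto
  also have "\<dots> = (\<Oplus>z\<in>T. p (fst z) \<otimes> (q (snd z) \<otimes> r (m - fst z - snd z)))"
    using assms by (intro finsum_cong') (auto simp: h_def m_assoc)
  also have "\<dots> = (\<Oplus>k\<in>{k. k \<subseteq># m}. \<Oplus>l\<in>{l. l \<subseteq># m - k}. p k \<otimes> (q l \<otimes> r (m - k - l)))"
    unfolding T_def using assms by (intro add.finprod_Sigma[symmetric]) (auto simp: finite_subset_mset)
  also have "\<dots> = (p \<otimes>\<^bsub>mpoly_ring R V\<^esub> (q \<otimes>\<^bsub>mpoly_ring R V\<^esub> r)) m"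
    unfolding mpoly_mult using assms
    by (intro finsum_cong' refl)
      (auto intro!: finsum_rdistr[symmetric] finsum_closed simp: finite_subset_mset)
  finally show "((p \<otimes>\<^bsub>mpoly_ring R V\<^esub> q) \<otimes>\<^bsub>mpoly_ring R V\<^esub> r) m =
    (p \<otimes>\<^bsub>mpoly_ring R V\<^esub> (q \<otimes>\<^bsub>mpoly_ring R V\<^esub> r)) m" .
qed

section \<open>Monomials and the ring axioms\<close>

definition mpoly_monom :: "'a \<Rightarrow> 'v multiset \<Rightarrow> 'v multiset \<Rightarrow> 'a"
  where "mpoly_monom a n = (\<lambda>m. if m = n then a else \<zero>)"

lemma mpoly_monom_closed:
  assumes "a \<in> carrier R" "set_mset n \<subseteq> V"
  shows "mpoly_monom a n \<in> carrier (mpoly_ring R V)"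
proof -
  have "finite {m. mpoly_monom a n m \<noteq> \<zero>}"
    by (rule finite_subset[of _ "{n}"]) (auto simp: mpoly_monom_def)
  with assms show ?thesis
    by (auto simp: mpoly_carrier_iff mpoly_monom_def split: if_splits)
qed

text \<open>Only the summand at \<open>n\<close> survives in the convolution, so the coefficients of
  \<open>q\<close> are shifted by \<open>n\<close> and scaled by \<open>a\<close>. The unit law and
  the multiplication by constants and variables are instances.\<close>

lemma mpoly_monom_mult:
  assumes "a \<in> carrier R" "q \<in> carrier (mpoly_ring R V)"
  shows "(mpoly_monom a n \<otimes>\<^bsub>mpoly_ring R V\<^esub> q) m = (if n \<subseteq># m then a \<otimes> q (m - n) else \<zero>)"
proof (cases "n \<subseteq># m")
  case True
  have "(mpoly_monom a n \<otimes>\<^bsub>mpoly_ring R V\<^esub> q) m =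
      (\<Oplus>k\<in>{k. k \<subseteq># m}. if n = k then a \<otimes> q (m - k) else \<zero>)"
    unfolding mpoly_mult using assms by (intro finsum_cong') (auto simp: mpoly_monom_def)
  also have "\<dots> = a \<otimes> q (m - n)"
    using assms True by (intro finsum_singleton) (auto simp: finite_subset_mset)
  finally show ?thesis using True by simp
next
  case False
  then show ?thesis
    unfolding mpoly_mult using assms by (auto intro!: add.finprod_one_eqI simp: mpoly_monom_def)
qed

lemma mpoly_one_monom: "\<one>\<^bsub>mpoly_ring R V\<^esub> = mpoly_monom \<one> {#}"
  by (simp add: mpoly_monom_def)

lemma mpoly_ring_cring: "cring (mpoly_ring R V)"
proof (rule cringI)
  show "abelian_group (mpoly_ring R V)"
  proof (rule abelian_groupI)
    fix p assume p: "p \<in> carrier (mpoly_ring R V)"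
    have "\<ominus> p m \<noteq> \<zero> \<longleftrightarrow> p m \<noteq> \<zero>" for m
      using p by (metis minus_minus mpoly_coeff_closed minus_zero)
    then have "(\<lambda>m. \<ominus> p m) \<in> carrier (mpoly_ring R V)"
      using p by (auto simp: mpoly_carrier_iff)
    moreover have "(\<lambda>m. \<ominus> p m) \<oplus>\<^bsub>mpoly_ring R V\<^esub> p = \<zero>\<^bsub>mpoly_ring R V\<^esub>"
      using p by (simp add: l_neg)
    ultimately show "\<exists>q\<in>carrier (mpoly_ring R V). q \<oplus>\<^bsub>mpoly_ring R V\<^esub> p = \<zero>\<^bsub>mpoly_ring R V\<^esub>"
      by blast
  next
    show "\<zero>\<^bsub>mpoly_ring R V\<^esub> \<in> carrier (mpoly_ring R V)"
      by (simp add: mpoly_carrier_iff)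
  qed (auto simp: mpoly_add_closed[unfolded mpoly_ring_simps] a_assoc a_comm a_lcomm)
next
  show "comm_monoid (mpoly_ring R V)"
  proof (rule comm_monoidI)
    fix p assume p: "p \<in> carrier (mpoly_ring R V)"
    show "\<one>\<^bsub>mpoly_ring R V\<^esub> \<otimes>\<^bsub>mpoly_ring R V\<^esub> p = p"
      unfolding mpoly_one_monom using p by (auto simp: mpoly_monom_mult)
  next
    show "\<one>\<^bsub>mpoly_ring R V\<^esub> \<in> carrier (mpoly_ring R V)"
      unfolding mpoly_one_monom by (intro mpoly_monom_closed) auto
  qed (fact mpoly_mult_closed mpoly_m_assoc mpoly_m_comm)+
next
  fix p q r
  assume pqr: "p \<in> carrier (mpoly_ring R V)" "q \<in> carrier (mpoly_ring R V)"
    "r \<in> carrier (mpoly_ring R V)"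
  show "(p \<oplus>\<^bsub>mpoly_ring R V\<^esub> q) \<otimes>\<^bsub>mpoly_ring R V\<^esub> r =
    p \<otimes>\<^bsub>mpoly_ring R V\<^esub> r \<oplus>\<^bsub>mpoly_ring R V\<^esub> q \<otimes>\<^bsub>mpoly_ring R V\<^esub> r"
  proof
    fix m
    have "((p \<oplus>\<^bsub>mpoly_ring R V\<^esub> q) \<otimes>\<^bsub>mpoly_ring R V\<^esub> r) m =
        (\<Oplus>n\<in>{n. n \<subseteq># m}. p n \<otimes> r (m - n) \<oplus> q n \<otimes> r (m - n))"
      unfolding mpoly_mult using pqr by (intro finsum_cong') (auto simp: l_distr)
    also have "\<dots> = (p \<otimes>\<^bsub>mpoly_ring R V\<^esub> r \<oplus>\<^bsub>mpoly_ring R V\<^esub> q \<otimes>\<^bsub>mpoly_ring R V\<^esub> r) m"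
      using pqr by (simp add: mpoly_mult finsum_addf Pi_def)
    finally show "((p \<oplus>\<^bsub>mpoly_ring R V\<^esub> q) \<otimes>\<^bsub>mpoly_ring R V\<^esub> r) m =
      (p \<otimes>\<^bsub>mpoly_ring R V\<^esub> r \<oplus>\<^bsub>mpoly_ring R V\<^esub> q \<otimes>\<^bsub>mpoly_ring R V\<^esub> r) m" .
  qed
qed

end


section \<open>Evaluation of polynomials\<close>

definition (in cring) mpoly_var :: "'v \<Rightarrow> 'v multiset \<Rightarrow> 'a"
  where "mpoly_var v = mpoly_monom \<one> {#v#}"

text \<open>The monomial factor of \<open>mpoly_eval\<close>, split off so that its multiplicativity
  can be treated apart from the sum over the support.\<close>

definition monom_value :: "('b, 'n) ring_scheme \<Rightarrow> ('v \<Rightarrow> 'b) \<Rightarrow> 'v multiset \<Rightarrow> 'b"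
  where "monom_value S b m = (\<Otimes>\<^bsub>S\<^esub>i\<in>set_mset m. b i [^]\<^bsub>S\<^esub> count m i)"

lemma mpoly_eval_alt:
  "mpoly_eval R S f b p = (\<Oplus>\<^bsub>S\<^esub>m\<in>{m. p m \<noteq> \<zero>\<^bsub>R\<^esub>}. f (p m) \<otimes>\<^bsub>S\<^esub> monom_value S b m)"
  by (simp add: mpoly_eval_def monom_value_def)

context cring
begin

lemma monom_value_closed [simp, intro]:
  "b \<in> set_mset m \<rightarrow> carrier R \<Longrightarrow> monom_value R b m \<in> carrier R"
  unfolding monom_value_def by (auto intro!: finprod_closed)

text \<open>A variable outside \<open>m\<close> has exponent 0 and contributes the factor 1. Hence
  monomials in different variables can be evaluated over one common index set.\<close>

lemma monom_value_superset:
  assumes "set_mset m \<subseteq> W" "finite W" "b \<in> W \<rightarrow> carrier R"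
  shows "monom_value R b m = (\<Otimes>i\<in>W. b i [^] count m i)"
  unfolding monom_value_def using assms
  by (intro finprod_mono_neutral_cong_left) (auto simp: not_in_iff)

lemma monom_value_add:
  assumes "b \<in> set_mset (n + k) \<rightarrow> carrier R"
  shows "monom_value R b (n + k) = monom_value R b n \<otimes> monom_value R b k"
proof -
  let ?W = "set_mset (n + k)"
  have "monom_value R b (n + k) = (\<Otimes>i\<in>?W. b i [^] count n i \<otimes> b i [^] count k i)"
    unfolding monom_value_def using assms by (intro finprod_cong') (auto simp: nat_pow_mult Pi_iff)
  also have "\<dots> = (\<Otimes>i\<in>?W. b i [^] count n i) \<otimes> (\<Otimes>i\<in>?W. b i [^] count k i)"
    using assms by (intro finprod_multf) auto
  also have "\<dots> = monom_value R b n \<otimes> monom_value R b k"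
    using monom_value_superset[of n ?W b] monom_value_superset[of k ?W b] assms by simp
  finally show ?thesis .
qed

lemma monom_value_empty [simp]: "monom_value R b {#} = \<one>"
  by (simp add: monom_value_def)

lemma monom_value_single [simp]: "b v \<in> carrier R \<Longrightarrow> monom_value R b {#v#} = b v"
  by (simp add: monom_value_def)

lemma mpoly_var_closed [simp, intro]: "v \<in> V \<Longrightarrow> mpoly_var v \<in> carrier (mpoly_ring R V)"
  unfolding mpoly_var_def by (rule mpoly_monom_closed) auto

end

context ring_hom_cring
begin

text \<open>Vanishing coefficients contribute nothing, so polynomials with different supports can be
  summed over the same \<open>M\<close>. The monomials in \<open>M\<close> are kept inside
  \<open>V\<close>, where \<open>b\<close> is known to take values in \<open>S\<close>.\<close>

lemma mpoly_eval_superset: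
  assumes "p \<in> carrier (mpoly_ring R V)" "b \<in> V \<rightarrow> carrier S"
    and "{m. p m \<noteq> \<zero>} \<subseteq> M" "finite M" "\<And>m. m \<in> M \<Longrightarrow> set_mset m \<subseteq> V"
  shows "mpoly_eval R S h b p = (\<Oplus>\<^bsub>S\<^esub>m\<in>M. h (p m) \<otimes>\<^bsub>S\<^esub> monom_value S b m)"
proof -
  have "monom_value S b m \<in> carrier S" if "m \<in> M" for m
    using assms(2) assms(5)[OF that] by (intro S.monom_value_closed) blast
  then show ?thesis
    unfolding mpoly_eval_alt using assms
    by (intro S.add.finprod_mono_neutral_cong_left) auto
qed

lemma mpoly_eval_closed:
  assumes "p \<in> carrier (mpoly_ring R V)" "b \<in> V \<rightarrow> carrier S"
  shows "mpoly_eval R S h b p \<in> carrier S"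
proof -
  have "monom_value S b m \<in> carrier S" if "p m \<noteq> \<zero>" for m
    using assms(2) mpoly_support_vars[OF assms(1) that] by (intro S.monom_value_closed) blast
  then show ?thesis
    unfolding mpoly_eval_alt using assms(1) by (intro S.finsum_closed) auto
qed

lemma mpoly_eval_monom:
  assumes "a \<in> carrier R" "b \<in> set_mset n \<rightarrow> carrier S"
  shows "mpoly_eval R S h b (R.mpoly_monom a n) = h a \<otimes>\<^bsub>S\<^esub> monom_value S b n"
proof -
  \<comment> \<open>The index set is \<open>{n}\<close> instead of the support, which is empty when
    \<open>a\<close> is zero.\<close>
  have "mpoly_eval R S h b (R.mpoly_monom a n) =
      (\<Oplus>\<^bsub>S\<^esub>m\<in>{n}. h (R.mpoly_monom a n m) \<otimes>\<^bsub>S\<^esub> monom_value S b m)"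
    by (rule mpoly_eval_superset[where V = "set_mset n"])
      (use assms in \<open>auto simp: R.mpoly_monom_closed\<close>, auto simp: R.mpoly_monom_def split: if_splits)
  with assms show ?thesis
    by (simp add: R.mpoly_monom_def)
qed

lemma mpoly_eval_var: "b v \<in> carrier S \<Longrightarrow> mpoly_eval R S h b (R.mpoly_var v) = b v"
  unfolding R.mpoly_var_def by (subst mpoly_eval_monom) auto

lemma mpoly_eval_const: "a \<in> carrier R \<Longrightarrow> mpoly_eval R S h b (R.mpoly_monom a {#}) = h a"
  by (subst mpoly_eval_monom) auto

text \<open>Every monomial of \<open>p\<close> uses variables of \<open>V\<close> only. This moves
  points between \<open>V\<close> and larger sets of variables.\<close>

lemma mpoly_eval_cong:
  assumes "p \<in> carrier (mpoly_ring R V)" "b \<in> V \<rightarrow> carrier S" "\<And>v. v \<in> V \<Longrightarrow> b v = b' v"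
  shows "mpoly_eval R S h b p = mpoly_eval R S h b' p"
proof -
  have *: "monom_value S b m = monom_value S b' m \<and> monom_value S b' m \<in> carrier S" if "p m \<noteq> \<zero>" for m
  proof -
    have "set_mset m \<subseteq> V" using mpoly_support_vars[OF assms(1) that] .
    with assms show ?thesis
      unfolding monom_value_def by (intro conjI S.finprod_cong' S.finprod_closed) (auto simp: Pi_iff)
  qed
  then show ?thesis
    unfolding mpoly_eval_alt using assms by (intro S.finsum_cong') auto
qed

lemma mpoly_eval_add:
  assumes "p \<in> carrier (mpoly_ring R V)" "q \<in> carrier (mpoly_ring R V)" "b \<in> V \<rightarrow> carrier S"
  shows "mpoly_eval R S h b (p \<oplus>\<^bsub>mpoly_ring R V\<^esub> q) =
    mpoly_eval R S h b p \<oplus>\<^bsub>S\<^esub> mpoly_eval R S h b q"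
proof -
  \<comment> \<open>Cancellation can make the support of the sum smaller than this union, which
    serves for all three evaluations.\<close>
  define M where "M = {m. p m \<noteq> \<zero>} \<union> {m. q m \<noteq> \<zero>}"
  have fin: "finite M"
    using assms(1,2) by (auto simp: M_def intro: mpoly_finite_support)
  have vars: "set_mset m \<subseteq> V" if "m \<in> M" for m
    using that assms(1,2)[THEN mpoly_support_vars] unfolding M_def by blast
  then have mon: "monom_value S b m \<in> carrier S" if "m \<in> M" for m
    using assms(3) that by (intro S.monom_value_closed) blast
  have "mpoly_eval R S h b (p \<oplus>\<^bsub>mpoly_ring R V\<^esub> q) =
      (\<Oplus>\<^bsub>S\<^esub>m\<in>M. h ((p \<oplus>\<^bsub>mpoly_ring R V\<^esub> q) m) \<otimes>\<^bsub>S\<^esub> monom_value S b m)"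
    by (rule mpoly_eval_superset[OF R.mpoly_add_closed[OF assms(1,2)] assms(3) _ fin vars])
      (auto simp: M_def)
  also have "\<dots> = (\<Oplus>\<^bsub>S\<^esub>m\<in>M. h (p m) \<otimes>\<^bsub>S\<^esub> monom_value S b m \<oplus>\<^bsub>S\<^esub> h (q m) \<otimes>\<^bsub>S\<^esub> monom_value S b m)"
    using assms mon by (intro S.finsum_cong') (auto simp: S.l_distr)
  also have "\<dots> = (\<Oplus>\<^bsub>S\<^esub>m\<in>M. h (p m) \<otimes>\<^bsub>S\<^esub> monom_value S b m) \<oplus>\<^bsub>S\<^esub>
      (\<Oplus>\<^bsub>S\<^esub>m\<in>M. h (q m) \<otimes>\<^bsub>S\<^esub> monom_value S b m)"
    using assms mon by (intro S.finsum_addf) auto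
  also have "\<dots> = mpoly_eval R S h b p \<oplus>\<^bsub>S\<^esub> mpoly_eval R S h b q"
    using assms fin vars by (subst (1 2) mpoly_eval_superset[of _ V b M]) (auto simp: M_def)
  finally show ?thesis .
qed

text \<open>Both sides are brought to the sum of \<open>F n k\<close> over
  \<open>P \<times> Q\<close>. The left side starts as a sum over the pairs \<open>(m, n)\<close> in
  \<open>T\<close>, among which the pair \<open>(n, k)\<close> appears as
  \<open>(n + k, n)\<close>.\<close>

lemma mpoly_eval_mult:
  fixes p q :: "'v multiset \<Rightarrow> 'a"
  assumes p: "p \<in> carrier (mpoly_ring R V)" and q: "q \<in> carrier (mpoly_ring R V)"
    and b: "b \<in> V \<rightarrow> carrier S"
  shows "mpoly_eval R S h b (p \<otimes>\<^bsub>mpoly_ring R V\<^esub> q) =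
    mpoly_eval R S h b p \<otimes>\<^bsub>S\<^esub> mpoly_eval R S h b q"
proof -
  define P where "P = {m. p m \<noteq> \<zero>}"
  define Q where "Q = {m. q m \<noteq> \<zero>}"
  define M where "M = (\<lambda>(n, k). n + k) ` (P \<times> Q)"
  define F where "F n k = (h (p n) \<otimes>\<^bsub>S\<^esub> monom_value S b n) \<otimes>\<^bsub>S\<^esub> (h (q k) \<otimes>\<^bsub>S\<^esub> monom_value S b k)" for n k
  define T where "T = (SIGMA m:M. {n. n \<subseteq># m})"
  have fin: "finite P" "finite Q" "finite M"
    using p q by (auto simp: P_def Q_def M_def intro: mpoly_finite_support)
  have PV: "set_mset m \<subseteq> V" if "m \<in> P" for m
    using that mpoly_support_vars[OF p] unfolding P_def by blast
  have QV: "set_mset m \<subseteq> V" if "m \<in> Q" for m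
    using that mpoly_support_vars[OF q] unfolding Q_def by blast
  have MV: "set_mset m \<subseteq> V" if "m \<in> M" for m
    using that PV QV unfolding M_def by fastforce
  have mon: "monom_value S b m \<in> carrier S" if "set_mset m \<subseteq> V" for m
    using b that by (intro S.monom_value_closed) blast
  have sub: "set_mset n \<subseteq> V" "set_mset (m - n) \<subseteq> V" if "m \<in> M" "n \<subseteq># m" for m n
    using MV[OF that(1)] that(2) by (auto dest: mset_subset_eqD in_diffD)
  have summand: "h (p n \<otimes> q (m - n)) \<otimes>\<^bsub>S\<^esub> monom_value S b m = F n (m - n)"
    if m: "m \<in> M" "n \<subseteq># m" for m n
  proof -
    have "set_mset (n + (m - n)) \<subseteq> V"
      using sub[OF m] by (simp only: set_mset_union Un_least)
    with b have "b \<in> set_mset (n + (m - n)) \<rightarrow> carrier S"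
      by blast
    from S.monom_value_add[OF this]
    have "monom_value S b m = monom_value S b n \<otimes>\<^bsub>S\<^esub> monom_value S b (m - n)"
      using m by (simp add: subset_mset.add_diff_inverse)
    moreover have "monom_value S b n \<in> carrier S" "monom_value S b (m - n) \<in> carrier S"
      by (rule mon, rule sub[OF m])+
    moreover have "h (p n) \<in> carrier S" "h (q (m - n)) \<in> carrier S"
      "h (p n \<otimes> q (m - n)) = h (p n) \<otimes>\<^bsub>S\<^esub> h (q (m - n))"
      using p q by (simp_all add: mpoly_coeff_closed)
    ultimately show ?thesis
      unfolding F_def by (simp add: S.m_ac)
  qed
  have F_closed: "F n k \<in> carrier S" if "set_mset n \<subseteq> V" "set_mset k \<subseteq> V" for n k
    unfolding F_def using p q mon that by (simp add: mpoly_coeff_closed)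
  have P_closed: "h (p n) \<otimes>\<^bsub>S\<^esub> monom_value S b n \<in> carrier S" if "n \<in> P" for n
    using mon[OF PV[OF that]] p by simp
  have Q_closed: "h (q n) \<otimes>\<^bsub>S\<^esub> monom_value S b n \<in> carrier S" if "n \<in> Q" for n
    using mon[OF QV[OF that]] q by simp
  have F_zero: "F n k = \<zero>\<^bsub>S\<^esub>" if "set_mset n \<subseteq> V" "set_mset k \<subseteq> V" "n \<notin> P \<or> k \<notin> Q" for n k
    using that p q mon by (auto simp: F_def P_def Q_def mpoly_coeff_closed)
  have "mpoly_eval R S h b (p \<otimes>\<^bsub>mpoly_ring R V\<^esub> q) =
      (\<Oplus>\<^bsub>S\<^esub>m\<in>M. h ((p \<otimes>\<^bsub>mpoly_ring R V\<^esub> q) m) \<otimes>\<^bsub>S\<^esub> monom_value S b m)"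
    using R.mpoly_mult_support[OF p q] unfolding P_def[symmetric] Q_def[symmetric] M_def[symmetric]
    by (rule mpoly_eval_superset[OF R.mpoly_mult_closed[OF p q] b _ fin(3) MV])
  also have "\<dots> = (\<Oplus>\<^bsub>S\<^esub>m\<in>M. \<Oplus>\<^bsub>S\<^esub>n\<in>{n. n \<subseteq># m}. F n (m - n))"
  proof (rule S.finsum_cong')
    fix m assume m: "m \<in> M"
    have "h ((p \<otimes>\<^bsub>mpoly_ring R V\<^esub> q) m) = (\<Oplus>\<^bsub>S\<^esub>n\<in>{n. n \<subseteq># m}. h (p n \<otimes> q (m - n)))"
      unfolding mpoly_mult using p q by (subst hom_finsum) (auto simp: o_def)
    then have "h ((p \<otimes>\<^bsub>mpoly_ring R V\<^esub> q) m) \<otimes>\<^bsub>S\<^esub> monom_value S b m =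
        (\<Oplus>\<^bsub>S\<^esub>n\<in>{n. n \<subseteq># m}. h (p n \<otimes> q (m - n)) \<otimes>\<^bsub>S\<^esub> monom_value S b m)"
      using p q mon[OF MV[OF m]] by (simp only:) (intro S.finsum_ldistr, auto simp: finite_subset_mset)
    also have "\<dots> = (\<Oplus>\<^bsub>S\<^esub>n\<in>{n. n \<subseteq># m}. F n (m - n))"
      using summand[OF m] F_closed sub[OF m] by (intro S.finsum_cong') auto
    finally show "h ((p \<otimes>\<^bsub>mpoly_ring R V\<^esub> q) m) \<otimes>\<^bsub>S\<^esub> monom_value S b m =
      (\<Oplus>\<^bsub>S\<^esub>n\<in>{n. n \<subseteq># m}. F n (m - n))" .
  qed (use F_closed sub in \<open>auto intro!: S.finsum_closed\<close>)
  also have "\<dots> = (\<Oplus>\<^bsub>S\<^esub>z\<in>T. F (snd z) (fst z - snd z))"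
    unfolding T_def using fin F_closed sub by (intro S.add.finprod_Sigma) (auto simp: finite_subset_mset)
  \<comment> \<open>A pair \<open>(m, n)\<close> outside the image has \<open>n\<close> outside
    \<open>P\<close> or \<open>m - n\<close> outside \<open>Q\<close>, so its summand has a zero
    factor.\<close>
  also have "\<dots> = (\<Oplus>\<^bsub>S\<^esub>z\<in>(\<lambda>(n, k). (n + k, n)) ` (P \<times> Q). F (snd z) (fst z - snd z))"
  proof (rule S.add.finprod_mono_neutral_cong_right)
    show "finite T"
      unfolding T_def using fin by (auto simp: finite_subset_mset)
    show "(\<lambda>(n, k). (n + k, n)) ` (P \<times> Q) \<subseteq> T"
      by (auto simp: T_def M_def)
  next
    fix z assume z: "z \<in> T - (\<lambda>(n, k). (n + k, n)) ` (P \<times> Q)"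
    then obtain m n where mn: "z = (m, n)" "m \<in> M" "n \<subseteq># m"
      by (auto simp: T_def)
    have "n \<notin> P \<or> m - n \<notin> Q"
    proof (rule ccontr)
      assume "\<not> ?thesis"
      with mn have "z \<in> (\<lambda>(n, k). (n + k, n)) ` (P \<times> Q)"
        by (intro image_eqI[of _ _ "(n, m - n)"]) auto
      with z show False by blast
    qed
    then show "F (snd z) (fst z - snd z) = \<zero>\<^bsub>S\<^esub>"
      using F_zero[OF sub[OF mn(2,3)]] by (simp add: mn(1))
  next
    show "(\<lambda>z. F (snd z) (fst z - snd z)) \<in> T \<rightarrow> carrier S"
      using F_closed[OF sub] by (auto simp: T_def)
  qed (rule refl)
  also have "\<dots> = (\<Oplus>\<^bsub>S\<^esub>z\<in>P \<times> Q. F (snd (fst z + snd z, fst z)) (fst (fst z + snd z, fst z) - snd (fst z + snd z, fst z)))"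
    unfolding case_prod_beta using F_closed[OF PV QV]
    by (intro S.finsum_reindex) (auto simp: inj_on_def)
  also have "\<dots> = (\<Oplus>\<^bsub>S\<^esub>z\<in>P \<times> Q. F (fst z) (snd z))"
    by simp
  also have "\<dots> = (\<Oplus>\<^bsub>S\<^esub>n\<in>P. \<Oplus>\<^bsub>S\<^esub>k\<in>Q. F n k)"
    by (rule S.add.finprod_Sigma[symmetric]) (use fin F_closed[OF PV QV] in auto)
  also have "\<dots> = (\<Oplus>\<^bsub>S\<^esub>n\<in>P. (h (p n) \<otimes>\<^bsub>S\<^esub> monom_value S b n) \<otimes>\<^bsub>S\<^esub> mpoly_eval R S h b q)"
  proof (rule S.finsum_cong'[OF refl])
    fix n assume "n \<in> P"
    then show "(\<Oplus>\<^bsub>S\<^esub>k\<in>Q. F n k) = (h (p n) \<otimes>\<^bsub>S\<^esub> monom_value S b n) \<otimes>\<^bsub>S\<^esub> mpoly_eval R S h b q"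
      unfolding F_def mpoly_eval_alt Q_def[symmetric] using P_closed Q_closed fin
      by (intro S.finsum_rdistr[symmetric]) blast+
  qed (use P_closed mpoly_eval_closed[OF q b] in blast)
  also have "\<dots> = mpoly_eval R S h b p \<otimes>\<^bsub>S\<^esub> mpoly_eval R S h b q"
    unfolding mpoly_eval_alt[of _ _ _ _ p] P_def[symmetric]
    using fin P_closed mpoly_eval_closed[OF q b] by (intro S.finsum_ldistr[symmetric]) blast+
  finally show ?thesis .
qed

lemma mpoly_eval_hom:
  assumes "b \<in> V \<rightarrow> carrier S"
  shows "ring_hom_cring (mpoly_ring R V) S (mpoly_eval R S h b)"
proof -
  have "mpoly_eval R S h b \<one>\<^bsub>mpoly_ring R V\<^esub> = \<one>\<^bsub>S\<^esub>"
    unfolding R.mpoly_one_monom by (simp add: mpoly_eval_const)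
  then have "mpoly_eval R S h b \<in> ring_hom (mpoly_ring R V) S"
    by (intro ring_hom_memI mpoly_eval_closed[OF _ assms] mpoly_eval_add[OF _ _ assms]
        mpoly_eval_mult[OF _ _ assms])
  then show ?thesis
    by (intro ring_hom_cring.intro ring_hom_cring_axioms.intro R.mpoly_ring_cring S.cring_axioms)
qed

end

section \<open>Universal property of the polynomial ring and zeros of ideals\<close>

lemma ring_hom_cringI2:
  assumes "cring R" "cring S" "h \<in> ring_hom R S"
  shows "ring_hom_cring R S h"
  using assms by (simp add: ring_hom_cring_def ring_hom_cring_axioms_def)

lemma ring_hom_cring_comp:
  assumes "ring_hom_cring R S h" "ring_hom_cring S T k"
  shows "ring_hom_cring R T (k \<circ> h)"
  using assms by (auto simp: ring_hom_cring_def ring_hom_cring_axioms_def intro: ring_hom_trans)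

context cring
begin

lemma mpoly_const_hom:
  fixes V :: "'v set"
  shows "ring_hom_cring R (mpoly_ring R V) (\<lambda>a. mpoly_monom a {#})"
proof -
  have "(\<lambda>a. mpoly_monom a {#}) \<in> ring_hom R (mpoly_ring R V)"
  proof (rule ring_hom_memI)
    fix a b assume ab: "a \<in> carrier R" "b \<in> carrier R"
    show "mpoly_monom (a \<otimes> b) {#} =
      mpoly_monom a {#} \<otimes>\<^bsub>mpoly_ring R V\<^esub> (mpoly_monom b {#} :: 'v multiset \<Rightarrow> 'a)"
    proof
      fix m :: "'v multiset"
      have "(mpoly_monom a {#} \<otimes>\<^bsub>mpoly_ring R V\<^esub> mpoly_monom b {#}) m =
          (if {#} \<subseteq># m then a \<otimes> mpoly_monom b {#} (m - {#}) else \<zero>)"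
        using ab by (intro mpoly_monom_mult mpoly_monom_closed) auto
      then show "mpoly_monom (a \<otimes> b) {#} m =
          (mpoly_monom a {#} \<otimes>\<^bsub>mpoly_ring R V\<^esub> mpoly_monom b {#}) m"
        using ab by (simp add: mpoly_monom_def)
    qed
    show "mpoly_monom (a \<oplus> b) {#} =
      mpoly_monom a {#} \<oplus>\<^bsub>mpoly_ring R V\<^esub> (mpoly_monom b {#} :: 'v multiset \<Rightarrow> 'a)"
      by (auto simp: fun_eq_iff mpoly_monom_def)
  qed (auto simp: mpoly_monom_closed mpoly_one_monom[symmetric], simp add: mpoly_monom_def)
  then show ?thesis
    by (intro ring_hom_cringI2 mpoly_ring_cring cring_axioms)
qed

lemma mpoly_monom_add_mset:
  assumes "a \<in> carrier R" "set_mset n \<subseteq> V"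
  shows "mpoly_monom a (add_mset v n) = mpoly_var v \<otimes>\<^bsub>mpoly_ring R V\<^esub> mpoly_monom a n"
proof
  fix m
  have "{#v#} \<subseteq># m \<and> m - {#v#} = n \<longleftrightarrow> m = add_mset v n"
    by auto
  moreover have "(mpoly_var v \<otimes>\<^bsub>mpoly_ring R V\<^esub> mpoly_monom a n) m =
      (if {#v#} \<subseteq># m then \<one> \<otimes> mpoly_monom a n (m - {#v#}) else \<zero>)"
    unfolding mpoly_var_def using assms by (intro mpoly_monom_mult mpoly_monom_closed one_closed)
  ultimately show "mpoly_monom a (add_mset v n) m =
      (mpoly_var v \<otimes>\<^bsub>mpoly_ring R V\<^esub> mpoly_monom a n) m"
    using assms by (auto simp: mpoly_monom_def)
qed

text \<open>Induction on the support: \<open>p(n := \<zero>)\<close> loses the monomial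
  \<open>n\<close> and no other, and adding \<open>mpoly_monom (p n) n\<close> restores
  \<open>p\<close>.\<close>

lemma mpoly_carrier_induct [consumes 1, case_names zero monom_add]:
  assumes "p \<in> carrier (mpoly_ring R V)"
    and "P (\<lambda>m. \<zero>)"
    and "\<And>a n p. a \<in> carrier R \<Longrightarrow> set_mset n \<subseteq> V \<Longrightarrow> p \<in> carrier (mpoly_ring R V) \<Longrightarrow> P p \<Longrightarrow>
      P (mpoly_monom a n \<oplus>\<^bsub>mpoly_ring R V\<^esub> p)"
  shows "P p"
proof -
  have "finite {m. p m \<noteq> \<zero>}"
    using assms(1) by (rule mpoly_finite_support)
  then show ?thesis
    using assms(1)
  proof (induction "{m. p m \<noteq> \<zero>}" arbitrary: p rule: finite_induct)
    case empty
    then have "p = (\<lambda>m. \<zero>)" by auto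
    with assms(2) show ?case by simp
  next
    case (insert n M)
    define q where "q = p(n := \<zero>)"
    have M: "M = {m. q m \<noteq> \<zero>}"
      using insert.hyps by (auto simp: q_def)
    have "q \<in> carrier (mpoly_ring R V)"
      using insert.prems insert.hyps(1) unfolding mpoly_carrier_iff M[symmetric]
      by (auto simp: q_def)
    moreover have "set_mset n \<subseteq> V"
      using mpoly_support_vars[OF insert.prems] insert.hyps(4) by blast
    moreover have "p = mpoly_monom (p n) n \<oplus>\<^bsub>mpoly_ring R V\<^esub> q"
      using insert.prems by (auto simp: fun_eq_iff q_def mpoly_monom_def)
    ultimately show ?case
      using assms(3)[of "p n" n q] insert.hyps(3)[OF M] insert.prems by auto
  qed
qed

text \<open>Constants and variables generate the polynomial ring: induction on the multiset reaches
  the monomials, and adding monomials reaches every polynomial.\<close>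

lemma mpoly_hom_unique:
  assumes "ring_hom_cring (mpoly_ring R V) S \<phi>" "ring_hom_cring (mpoly_ring R V) S \<psi>"
    and const: "\<And>a. a \<in> carrier R \<Longrightarrow> \<phi> (mpoly_monom a {#}) = \<psi> (mpoly_monom a {#})"
    and var: "\<And>v. v \<in> V \<Longrightarrow> \<phi> (mpoly_var v) = \<psi> (mpoly_var v)"
    and "p \<in> carrier (mpoly_ring R V)"
  shows "\<phi> p = \<psi> p"
proof -
  interpret \<phi>: ring_hom_cring "mpoly_ring R V" S \<phi> by fact
  interpret \<psi>: ring_hom_cring "mpoly_ring R V" S \<psi> by fact
  have monom: "\<phi> (mpoly_monom a n) = \<psi> (mpoly_monom a n)"
    if "a \<in> carrier R" "set_mset n \<subseteq> V" for a n
    using that(2)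
  proof (induction n)
    case (add v n)
    then show ?case
      using that(1) mpoly_monom_add_mset[of a n V v]
      by (simp add: var mpoly_monom_closed mpoly_var_closed)
  qed (simp add: const that(1))
  show ?thesis
    using assms(5)
  proof (induction rule: mpoly_carrier_induct)
    case zero
    then show ?case using \<phi>.hom_zero \<psi>.hom_zero by simp
  next
    case (monom_add a n p)
    then show ?case
      by (simp add: monom mpoly_monom_closed del: mpoly_ring_simps)
  qed
qed

text \<open>A homomorphism is determined by its values on constants, which give the coefficient map,
  and on variables, which give the point. The point is restricted to \<open>V\<close> because
  members of \<open>zero_set\<close> are extensional.\<close>

lemma mpoly_hom_eq_eval:
  assumes "ring_hom_cring (mpoly_ring R V) S \<phi>" "p \<in> carrier (mpoly_ring R V)"
  shows "\<phi> p = mpoly_eval R S (\<lambda>a. \<phi> (mpoly_monom a {#})) (\<lambda>v\<in>V. \<phi> (mpoly_var v)) p"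
proof -
  interpret \<phi>: ring_hom_cring "mpoly_ring R V" S \<phi> by fact
  interpret h: ring_hom_cring R S "\<lambda>a. \<phi> (mpoly_monom a {#})"
    using ring_hom_cring_comp[OF mpoly_const_hom assms(1)] by (simp add: o_def)
  have b: "(\<lambda>v\<in>V. \<phi> (mpoly_var v)) \<in> V \<rightarrow> carrier S"
    by auto
  show ?thesis
    by (rule mpoly_hom_unique[OF assms(1) h.mpoly_eval_hom[OF b] _ _ assms(2)])
      (auto simp: h.mpoly_eval_const h.mpoly_eval_var)
qed

end

context ring_hom_cring
begin

text \<open>The polynomials that vanish at \<open>b\<close> form the kernel of an evaluation
  homomorphism, hence an ideal, which contains the ideal generated by \<open>E\<close> as soon as it
  contains \<open>E\<close>. Finitely generated ideals thus become finite systems of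
  equations.\<close>

lemma zero_set_genideal:
  assumes "E \<subseteq> carrier (mpoly_ring R V)"
  shows "zero_set R S h V (Idl\<^bsub>mpoly_ring R V\<^esub> E) = zero_set R S h V E"
proof -
  interpret P: cring "mpoly_ring R V" by (rule R.mpoly_ring_cring)
  have "\<forall>p\<in>Idl\<^bsub>mpoly_ring R V\<^esub> E. mpoly_eval R S h b p = \<zero>\<^bsub>S\<^esub>"
    if b: "b \<in> V \<rightarrow>\<^sub>E carrier S" and 0: "\<forall>p\<in>E. mpoly_eval R S h b p = \<zero>\<^bsub>S\<^esub>" for b
  proof -
    have "b \<in> V \<rightarrow> carrier S"
      using b by blast
    then have "mpoly_eval R S h b \<in> ring_hom (mpoly_ring R V) S"
      using mpoly_eval_hom ring_hom_cring.homh by blast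
    then have ideal: "ideal (a_kernel (mpoly_ring R V) S (mpoly_eval R S h b)) (mpoly_ring R V)"
      by (intro ring_hom_ring.kernel_is_ideal ring_hom_ringI2 P.ring_axioms S.ring_axioms)
    have "E \<subseteq> a_kernel (mpoly_ring R V) S (mpoly_eval R S h b)"
      unfolding a_kernel_def' using 0 assms by blast
    then show ?thesis
      using P.genideal_minimal[OF ideal] unfolding a_kernel_def' by blast
  qed
  moreover have "E \<subseteq> Idl\<^bsub>mpoly_ring R V\<^esub> E"
    using assms by (rule P.genideal_self)
  ultimately show ?thesis
    unfolding zero_set_def by blast
qed

end


section \<open>Ultrafilters and ultraproducts\<close>

text \<open>Zorn's lemma for the proper filters below \<open>F\<close>. A finer filter is a smaller
  one, so the order is reversed and the ultrafilter arises as a minimal proper filter.\<close>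

lemma ultrafilter_exists:
  fixes F :: "'i filter"
  assumes "F \<noteq> bot"
  obtains U where "U \<le> F" "U \<noteq> bot" "\<And>P. (\<forall>\<^sub>F i in U. P i) \<or> (\<forall>\<^sub>F i in U. \<not> P i)"
proof -
  define A where "A = {G. G \<noteq> bot \<and> G \<le> F}"
  have po: "partial_order_on A (relation_of (\<lambda>G H. H \<le> G) A)"
    by (auto simp: partial_order_on_def preorder_on_def refl_on_def trans_def antisym_def relation_of_def)
  have "\<exists>U\<in>A. \<forall>G\<in>A. G \<le> U \<longrightarrow> G = U"
  proof (rule predicate_Zorn[OF po])
    fix C assume "C \<in> Chains (relation_of (\<lambda>G H. H \<le> G) A)"
    then have C: "C \<subseteq> A" and chain: "\<And>G H. G \<in> C \<Longrightarrow> H \<in> C \<Longrightarrow> G \<le> H \<or> H \<le> G"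
      by (auto simp: Chains_def relation_of_def)
    show "\<exists>L\<in>A. \<forall>G\<in>C. L \<le> G"
    proof (cases "C = {}")
      case True
      with assms show ?thesis by (auto simp: A_def)
    next
      case False
      then obtain G where G: "G \<in> C" by blast
      \<comment> \<open>A chain is a filter base, so what holds eventually in its infimum holds
        eventually in one member. As no member makes falsity eventual, the infimum is
        proper.\<close>
      have "\<exists>K\<in>C. K \<le> inf G H" if "G \<in> C" "H \<in> C" for G H
        using chain[OF that] that by (metis inf.order_iff inf.commute order_refl)
      then have "eventually P (Inf C) \<longleftrightarrow> (\<exists>G\<in>C. eventually P G)" for P
        using False by (intro eventually_Inf_base)
      then have "Inf C \<noteq> bot"
        using C unfolding A_def trivial_limit_def by blast
      moreover have "Inf C \<le> F"
        using C G by (intro Inf_lower2[OF G]) (auto simp: A_def)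
      ultimately show ?thesis
        by (intro bexI[of _ "Inf C"]) (auto simp: A_def Inf_lower)
    qed
  qed
  then obtain U where U: "U \<in> A" and min: "\<And>G. G \<in> A \<Longrightarrow> G \<le> U \<Longrightarrow> G = U"
    by blast
  show thesis
  proof
    show "U \<le> F" "U \<noteq> bot"
      using U by (auto simp: A_def)
    show "(\<forall>\<^sub>F i in U. P i) \<or> (\<forall>\<^sub>F i in U. \<not> P i)" for P
    proof (rule disjCI)
      assume "\<not> (\<forall>\<^sub>F i in U. \<not> P i)"
      \<comment> \<open>Since \<open>U\<close> does not exclude \<open>P\<close>, adding
        \<open>P\<close> keeps the filter proper. By minimality nothing was added, so
        \<open>P\<close> already held eventually.\<close>
      then have "inf U (principal {i. P i}) \<noteq> bot"
        by (simp add: trivial_limit_def eventually_inf_principal)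
      then have eq: "inf U (principal {i. P i}) = U"
        using U by (intro min) (auto simp: A_def intro: le_infI1)
      have "\<forall>\<^sub>F i in inf U (principal {i. P i}). P i"
        by (simp add: eventually_inf_principal)
      then show "\<forall>\<^sub>F i in U. P i"
        unfolding eq .
    qed
  qed
qed

text \<open>
  The index set of an ultraproduct must be a small subset of \<open>'u\<close>, so the finite subsets of a
  carrier are indexed by its elements.
\<close>

lemma cofinal_finite_subsets:
  assumes "A \<noteq> {}"
  obtains e where "\<And>i. i \<in> A \<Longrightarrow> finite (e i) \<and> e i \<subseteq> A"
    "\<And>t. finite t \<Longrightarrow> t \<subseteq> A \<Longrightarrow> \<exists>i\<in>A. t \<subseteq> e i"
proof (cases "finite A")
  case True
  with assms that[of "\<lambda>_. A"] show thesis by blast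
next
  case False
  then obtain e where e: "bij_betw e A (Fpow A)"
    using eqpoll_Fpow eqpoll_sym unfolding eqpoll_def by blast
  have "finite (e i) \<and> e i \<subseteq> A" if "i \<in> A" for i
    using bij_betwE[OF e] that by (auto simp: Fpow_def)
  moreover have "\<exists>i\<in>A. t \<subseteq> e i" if "finite t" "t \<subseteq> A" for t
  proof -
    have "t \<in> e ` A"
      using that e by (auto simp: bij_betw_def Fpow_def)
    then show ?thesis by blast
  qed
  ultimately show thesis by (rule that)
qed

text \<open>The sets of all \<open>i\<close> in \<open>A\<close> with
  \<open>t \<subseteq> e i\<close> are nonempty by cofinality, and those for \<open>t\<close> and
  \<open>u\<close> intersect in the one for \<open>t \<union> u\<close>. They form the base of a
  proper filter, and any ultrafilter below it works.\<close>

lemma cofinal_ultrafilter: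
  assumes "\<And>t. finite t \<Longrightarrow> t \<subseteq> A \<Longrightarrow> \<exists>i\<in>A. t \<subseteq> e i"
  obtains U where "ultrafilter_on A U"
    "\<And>t. finite t \<Longrightarrow> t \<subseteq> A \<Longrightarrow> \<forall>\<^sub>F i in U. t \<subseteq> e i"
proof -
  define F where "F = (INF t\<in>Fpow A. principal {i\<in>A. t \<subseteq> e i})"
  have ev_F: "eventually P F \<longleftrightarrow> (\<exists>t\<in>Fpow A. eventually P (principal {i\<in>A. t \<subseteq> e i}))" for P
    unfolding F_def
  proof (rule eventually_INF_base)
    fix t u assume "t \<in> Fpow A" "u \<in> Fpow A"
    then show "\<exists>v\<in>Fpow A. principal {i \<in> A. v \<subseteq> e i} \<le>
        inf (principal {i \<in> A. t \<subseteq> e i}) (principal {i \<in> A. u \<subseteq> e i})"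
      by (intro bexI[of _ "t \<union> u"]) (auto simp: Fpow_def)
  qed (rule Fpow_not_empty)
  have "F \<noteq> bot"
    unfolding trivial_limit_def ev_F using assms by (fastforce simp: eventually_principal Fpow_def)
  then obtain U where U: "U \<le> F" "U \<noteq> bot" "\<And>P. (\<forall>\<^sub>F i in U. P i) \<or> (\<forall>\<^sub>F i in U. \<not> P i)"
    by (metis ultrafilter_exists)
  have cone: "\<forall>\<^sub>F i in U. i \<in> A \<and> t \<subseteq> e i" if "finite t" "t \<subseteq> A" for t
    by (rule filter_leD[OF U(1)]) (use that in \<open>auto simp: ev_F eventually_principal Fpow_def\<close>)
  have "\<forall>\<^sub>F i in U. i \<in> A"
    using cone[of "{}"] by simp
  with U have "ultrafilter_on A U"
    unfolding ultrafilter_on_def by blast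
  moreover have "\<forall>\<^sub>F i in U. t \<subseteq> e i" if "finite t" "t \<subseteq> A" for t
    using cone[OF that] by (rule eventually_mono) blast
  ultimately show thesis by (rule that)
qed

section \<open>Products of rings, ultraproducts and homomorphisms into them\<close>

lemma product_ring_simps [simp]:
  "carrier (product_ring I R) = (\<Pi>\<^sub>E i\<in>I. carrier (R i))"
  "x \<otimes>\<^bsub>product_ring I R\<^esub> y = (\<lambda>i\<in>I. x i \<otimes>\<^bsub>R i\<^esub> y i)"
  "\<one>\<^bsub>product_ring I R\<^esub> = (\<lambda>i\<in>I. \<one>\<^bsub>R i\<^esub>)"
  "\<zero>\<^bsub>product_ring I R\<^esub> = (\<lambda>i\<in>I. \<zero>\<^bsub>R i\<^esub>)"
  "x \<oplus>\<^bsub>product_ring I R\<^esub> y = (\<lambda>i\<in>I. x i \<oplus>\<^bsub>R i\<^esub> y i)"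
  by (simp_all add: product_ring_def)

lemma product_ring_ring:
  assumes "\<And>i. i \<in> I \<Longrightarrow> ring (R i)"
  shows "ring (product_ring I R)"
proof -
  note R = ring.ring_simprules[OF assms]
  note closed = R(1-3,5,6)
  show ?thesis
  proof (rule ringI)
    show "abelian_group (product_ring I R)"
    proof (rule abelian_groupI)
      fix x assume x: "x \<in> carrier (product_ring I R)"
      then have "(\<lambda>i\<in>I. \<ominus>\<^bsub>R i\<^esub> x i) \<in> carrier (product_ring I R)"
        by (auto simp: PiE_iff closed)
      moreover have "(\<lambda>i\<in>I. \<ominus>\<^bsub>R i\<^esub> x i) \<oplus>\<^bsub>product_ring I R\<^esub> x = \<zero>\<^bsub>product_ring I R\<^esub>"
        using x by (intro extensionalityI[of _ I]) (auto simp: PiE_iff R(9))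
      ultimately show "\<exists>y\<in>carrier (product_ring I R). y \<oplus>\<^bsub>product_ring I R\<^esub> x = \<zero>\<^bsub>product_ring I R\<^esub>"
        by blast
      show "\<zero>\<^bsub>product_ring I R\<^esub> \<oplus>\<^bsub>product_ring I R\<^esub> x = x"
        using x by (intro extensionalityI[of _ I]) (auto simp: PiE_iff R(8))
    next
      fix x y assume "x \<in> carrier (product_ring I R)" "y \<in> carrier (product_ring I R)"
      then show "x \<oplus>\<^bsub>product_ring I R\<^esub> y = y \<oplus>\<^bsub>product_ring I R\<^esub> x"
        by (intro extensionalityI[of _ I]) (auto simp: PiE_iff intro: R(10))
    next
      fix x y z
      assume "x \<in> carrier (product_ring I R)" "y \<in> carrier (product_ring I R)"
        "z \<in> carrier (product_ring I R)"
      then show "x \<oplus>\<^bsub>product_ring I R\<^esub> y \<oplus>\<^bsub>product_ring I R\<^esub> z =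
        x \<oplus>\<^bsub>product_ring I R\<^esub> (y \<oplus>\<^bsub>product_ring I R\<^esub> z)"
        by (intro extensionalityI[of _ I]) (auto simp: PiE_iff intro: R(7))
    qed (auto simp: PiE_iff closed)
    show "monoid (product_ring I R)"
    proof (rule monoidI)
      fix x assume x: "x \<in> carrier (product_ring I R)"
      then show "\<one>\<^bsub>product_ring I R\<^esub> \<otimes>\<^bsub>product_ring I R\<^esub> x = x"
        by (intro extensionalityI[of _ I]) (auto simp: PiE_iff R(12))
      show "x \<otimes>\<^bsub>product_ring I R\<^esub> \<one>\<^bsub>product_ring I R\<^esub> = x"
        using x by (intro extensionalityI[of _ I]) (auto simp: PiE_iff monoid.r_one[OF ring.is_monoid[OF assms]])
    next
      fix x y z
      assume "x \<in> carrier (product_ring I R)" "y \<in> carrier (product_ring I R)"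
        "z \<in> carrier (product_ring I R)"
      then show "x \<otimes>\<^bsub>product_ring I R\<^esub> y \<otimes>\<^bsub>product_ring I R\<^esub> z =
        x \<otimes>\<^bsub>product_ring I R\<^esub> (y \<otimes>\<^bsub>product_ring I R\<^esub> z)"
        by (intro extensionalityI[of _ I]) (auto simp: PiE_iff intro: R(11))
    qed (auto simp: PiE_iff closed)
  next
    fix x y z
    assume xyz: "x \<in> carrier (product_ring I R)" "y \<in> carrier (product_ring I R)"
      "z \<in> carrier (product_ring I R)"
    then show "(x \<oplus>\<^bsub>product_ring I R\<^esub> y) \<otimes>\<^bsub>product_ring I R\<^esub> z =
      x \<otimes>\<^bsub>product_ring I R\<^esub> z \<oplus>\<^bsub>product_ring I R\<^esub> y \<otimes>\<^bsub>product_ring I R\<^esub> z"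
      by (intro extensionalityI[of _ I]) (auto simp: PiE_iff intro: R(13))
    show "z \<otimes>\<^bsub>product_ring I R\<^esub> (x \<oplus>\<^bsub>product_ring I R\<^esub> y) =
      z \<otimes>\<^bsub>product_ring I R\<^esub> x \<oplus>\<^bsub>product_ring I R\<^esub> z \<otimes>\<^bsub>product_ring I R\<^esub> y"
      using xyz by (intro extensionalityI[of _ I]) (auto simp: PiE_iff intro: R(23))
  qed
qed

definition null_ideal :: "'i set \<Rightarrow> 'i filter \<Rightarrow> ('i \<Rightarrow> ('a, 'm) ring_scheme) \<Rightarrow> ('i \<Rightarrow> 'a) set"
  where "null_ideal I U R = {x \<in> carrier (product_ring I R). \<forall>\<^sub>F i in U. x i = \<zero>\<^bsub>R i\<^esub>}"

lemma ultraproduct_eq_Quot: "ultraproduct I U R = product_ring I R Quot null_ideal I U R"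
  by (simp only: ultraproduct_def null_ideal_def)

text \<open>Finitely many sets of \<open>U\<close> intersect in a set of \<open>U\<close>, which
  gives closure under the operations. Each such set is also intersected with \<open>I\<close>, since
  the operations of the product are componentwise on \<open>I\<close> only.\<close>

lemma null_ideal_ideal:
  assumes "\<And>i. i \<in> I \<Longrightarrow> ring (R i)" "\<forall>\<^sub>F i in U. i \<in> I"
  shows "ideal (null_ideal I U R) (product_ring I R)"
proof -
  interpret P: ring "product_ring I R"
    using assms(1) by (rule product_ring_ring)
  note simps = ring.ring_simprules[OF assms(1)]
  \<comment> \<open>Negation is a derived operation of the product; uniqueness of additive inverses
    identifies it with componentwise negation.\<close>
  have uminus: "\<ominus>\<^bsub>product_ring I R\<^esub> x = (\<lambda>i\<in>I. \<ominus>\<^bsub>R i\<^esub> x i)"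
    if "x \<in> carrier (product_ring I R)" for x
    using that by (intro P.minus_equality) (auto simp: PiE_iff simps intro!: restrict_ext)
  have add: "x \<oplus>\<^bsub>product_ring I R\<^esub> y \<in> null_ideal I U R"
    if "x \<in> null_ideal I U R" "y \<in> null_ideal I U R" for x y
  proof -
    have "\<forall>\<^sub>F i in U. x i = \<zero>\<^bsub>R i\<^esub> \<and> y i = \<zero>\<^bsub>R i\<^esub> \<and> i \<in> I"
      using that assms(2) by (auto simp: null_ideal_def eventually_conj_iff)
    then have "\<forall>\<^sub>F i in U. (x \<oplus>\<^bsub>product_ring I R\<^esub> y) i = \<zero>\<^bsub>R i\<^esub>"
      by (rule eventually_mono) (auto simp: simps)
    with that P.a_closed show ?thesis
      by (auto simp: null_ideal_def simp del: product_ring_simps)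
  qed
  have minus: "\<ominus>\<^bsub>product_ring I R\<^esub> x \<in> null_ideal I U R" if "x \<in> null_ideal I U R" for x
  proof -
    have x: "x \<in> carrier (product_ring I R)"
      using that by (auto simp: null_ideal_def)
    have "\<forall>\<^sub>F i in U. x i = \<zero>\<^bsub>R i\<^esub> \<and> i \<in> I"
      using that assms(2) by (auto simp: null_ideal_def eventually_conj_iff)
    then have "\<forall>\<^sub>F i in U. (\<ominus>\<^bsub>product_ring I R\<^esub> x) i = \<zero>\<^bsub>R i\<^esub>"
      unfolding uminus[OF x] by (rule eventually_mono) (auto simp: simps)
    with P.a_inv_closed[OF x] show ?thesis
      by (auto simp: null_ideal_def simp del: product_ring_simps)
  qed
  have mult: "x \<otimes>\<^bsub>product_ring I R\<^esub> a \<in> null_ideal I U R \<and> a \<otimes>\<^bsub>product_ring I R\<^esub> x \<in> null_ideal I U R"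
    if "a \<in> null_ideal I U R" and x: "x \<in> carrier (product_ring I R)" for a x
  proof -
    have a: "a \<in> carrier (product_ring I R)"
      using that by (auto simp: null_ideal_def)
    have ev: "\<forall>\<^sub>F i in U. a i = \<zero>\<^bsub>R i\<^esub> \<and> i \<in> I"
      using that assms(2) by (auto simp: null_ideal_def eventually_conj_iff)
    have "\<forall>\<^sub>F i in U. (x \<otimes>\<^bsub>product_ring I R\<^esub> a) i = \<zero>\<^bsub>R i\<^esub>"
      using ev by (rule eventually_mono)
        (use x in \<open>auto simp: PiE_iff simps\<close>)
    moreover have "\<forall>\<^sub>F i in U. (a \<otimes>\<^bsub>product_ring I R\<^esub> x) i = \<zero>\<^bsub>R i\<^esub>"
      using ev by (rule eventually_mono)
        (use x in \<open>auto simp: PiE_iff simps\<close>)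
    ultimately show ?thesis
      using P.m_closed[OF x a] P.m_closed[OF a x]
      by (auto simp: null_ideal_def simp del: product_ring_simps)
  qed
  show ?thesis
  proof (rule idealI[OF P.ring_axioms])
    show "subgroup (null_ideal I U R) (add_monoid (product_ring I R))"
    proof (rule P.add.subgroupI)
      have "\<zero>\<^bsub>product_ring I R\<^esub> \<in> null_ideal I U R"
        using P.zero_closed eventually_mono[OF assms(2), of "\<lambda>i. \<zero>\<^bsub>product_ring I R\<^esub> i = \<zero>\<^bsub>R i\<^esub>"]
        by (auto simp: null_ideal_def)
      then show "null_ideal I U R \<noteq> {}" by blast
      show "null_ideal I U R \<subseteq> carrier (product_ring I R)"
        by (auto simp: null_ideal_def)
    qed (fact add minus)+
  qed (use mult in blast)+
qed

text \<open>No single \<open>\<alpha> i\<close> has to be a homomorphism. For given arguments each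
  law holds for \<open>U\<close>-almost all \<open>i\<close>, and the class of the family \<alpha>
  only sees what happens almost everywhere.\<close>

lemma ultraproduct_hom:
  fixes U :: "'i filter"
  assumes R: "\<And>i. i \<in> I \<Longrightarrow> ring (R i)" and I: "\<forall>\<^sub>F i in U. i \<in> I"
    and closed: "\<And>i x. i \<in> I \<Longrightarrow> x \<in> carrier B \<Longrightarrow> \<alpha> i x \<in> carrier (R i)"
    and add: "\<And>x y. x \<in> carrier B \<Longrightarrow> y \<in> carrier B \<Longrightarrow>
      \<forall>\<^sub>F i in U. \<alpha> i (x \<oplus>\<^bsub>B\<^esub> y) = \<alpha> i x \<oplus>\<^bsub>R i\<^esub> \<alpha> i y"
    and mult: "\<And>x y. x \<in> carrier B \<Longrightarrow> y \<in> carrier B \<Longrightarrow>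
      \<forall>\<^sub>F i in U. \<alpha> i (x \<otimes>\<^bsub>B\<^esub> y) = \<alpha> i x \<otimes>\<^bsub>R i\<^esub> \<alpha> i y"
    and one: "\<forall>\<^sub>F i in U. \<alpha> i \<one>\<^bsub>B\<^esub> = \<one>\<^bsub>R i\<^esub>"
    and B: "ring B"
  obtains h where "h \<in> ring_hom B (ultraproduct I U R)"
    "\<And>x. x \<in> carrier B \<Longrightarrow> \<forall>\<^sub>F i in U. \<alpha> i x = \<zero>\<^bsub>R i\<^esub> \<Longrightarrow> h x = \<zero>\<^bsub>ultraproduct I U R\<^esub>"
proof -
  let ?P = "product_ring I R" and ?N = "null_ideal I U R"
  interpret B: ring B by fact
  interpret P: ring ?P using R by (rule product_ring_ring)
  interpret N: ideal ?N ?P using R I by (rule null_ideal_ideal)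
  \<comment> \<open>Restriction to \<open>I\<close> makes the family extensional, as elements of the
    product are.\<close>
  define \<beta> where "\<beta> x = (\<lambda>i\<in>I. \<alpha> i x)" for x
  define h where "h x = ?N +>\<^bsub>?P\<^esub> \<beta> x" for x
  have \<beta>: "\<beta> x \<in> carrier ?P" if "x \<in> carrier B" for x
    using closed that by (auto simp: \<beta>_def)
  have coset_eq: "?N +>\<^bsub>?P\<^esub> x = ?N +>\<^bsub>?P\<^esub> y"
    if x: "x \<in> carrier ?P" and y: "y \<in> carrier ?P" and "\<forall>\<^sub>F i in U. x i = y i" for x y
  proof -
    have "\<forall>\<^sub>F i in U. x i = y i \<and> i \<in> I"
      using that(3) I by (auto simp: eventually_conj_iff)
    moreover have "(x \<ominus>\<^bsub>?P\<^esub> y) i = \<zero>\<^bsub>R i\<^esub>" if "x i = y i \<and> i \<in> I" for i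
    proof -
      interpret Ri: ring "R i" using that R by blast
      have "x i \<in> carrier (R i)" "y i \<in> carrier (R i)" "(x \<ominus>\<^bsub>?P\<^esub> y) i \<in> carrier (R i)"
        using x y P.minus_closed[OF x y] that by auto
      \<comment> \<open>Reading (x - y) + y = x at the index \<open>i\<close> and cancelling
        \<open>y i\<close> avoids a componentwise formula for subtraction.\<close>
      moreover have "((x \<ominus>\<^bsub>?P\<^esub> y) \<oplus>\<^bsub>?P\<^esub> y) i = x i"
        using x y by (simp add: P.minus_eq P.a_assoc P.l_neg del: product_ring_simps)
      then have "(x \<ominus>\<^bsub>?P\<^esub> y) i \<oplus>\<^bsub>R i\<^esub> y i = x i"
        using that by simp
      ultimately show ?thesis
        using that by simp
    qed
    ultimately have "\<forall>\<^sub>F i in U. (x \<ominus>\<^bsub>?P\<^esub> y) i = \<zero>\<^bsub>R i\<^esub>"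
      by (rule eventually_mono)
    then have "x \<ominus>\<^bsub>?P\<^esub> y \<in> ?N"
      using P.minus_closed[OF x y] by (auto simp: null_ideal_def)
    then show ?thesis
      using P.quotient_eq_iff_same_a_r_cos[OF N.is_ideal x y] by blast
  qed
  have "h \<in> ring_hom B (ultraproduct I U R)"
    unfolding ultraproduct_eq_Quot
  proof (rule ring_hom_memI)
    fix x assume "x \<in> carrier B"
    then show "h x \<in> carrier (?P Quot ?N)"
      unfolding h_def by (intro ring_hom_closed[OF N.rcos_ring_hom] \<beta>)
  next
    fix x y assume xy: "x \<in> carrier B" "y \<in> carrier B"
    have "h (x \<otimes>\<^bsub>B\<^esub> y) = ?N +>\<^bsub>?P\<^esub> (\<beta> x \<otimes>\<^bsub>?P\<^esub> \<beta> y)"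
      unfolding h_def using eventually_conj[OF mult[OF xy] I]
      by (intro coset_eq P.m_closed \<beta> B.m_closed xy) (auto elim!: eventually_mono simp: \<beta>_def)
    then show "h (x \<otimes>\<^bsub>B\<^esub> y) = h x \<otimes>\<^bsub>?P Quot ?N\<^esub> h y"
      unfolding h_def using ring_hom_mult[OF N.rcos_ring_hom \<beta>[OF xy(1)] \<beta>[OF xy(2)]] by simp
    have "h (x \<oplus>\<^bsub>B\<^esub> y) = ?N +>\<^bsub>?P\<^esub> (\<beta> x \<oplus>\<^bsub>?P\<^esub> \<beta> y)"
      unfolding h_def using eventually_conj[OF add[OF xy] I]
      by (intro coset_eq P.a_closed \<beta> B.a_closed xy) (auto elim!: eventually_mono simp: \<beta>_def)
    then show "h (x \<oplus>\<^bsub>B\<^esub> y) = h x \<oplus>\<^bsub>?P Quot ?N\<^esub> h y"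
      unfolding h_def using ring_hom_add[OF N.rcos_ring_hom \<beta>[OF xy(1)] \<beta>[OF xy(2)]] by simp
  next
    have "h \<one>\<^bsub>B\<^esub> = ?N +>\<^bsub>?P\<^esub> \<one>\<^bsub>?P\<^esub>"
      unfolding h_def using eventually_conj[OF one I]
      by (intro coset_eq P.one_closed \<beta> B.one_closed) (auto elim!: eventually_mono simp: \<beta>_def)
    then show "h \<one>\<^bsub>B\<^esub> = \<one>\<^bsub>?P Quot ?N\<^esub>"
      using ring_hom_one[OF N.rcos_ring_hom] by simp
  qed
  moreover have "h x = \<zero>\<^bsub>ultraproduct I U R\<^esub>"
    if "x \<in> carrier B" "\<forall>\<^sub>F i in U. \<alpha> i x = \<zero>\<^bsub>R i\<^esub>" for x
  proof -
    have "h x = ?N +>\<^bsub>?P\<^esub> \<zero>\<^bsub>?P\<^esub>"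
      unfolding h_def using eventually_conj[OF that(2) I]
      by (intro coset_eq P.zero_closed \<beta> that) (auto elim!: eventually_mono simp: \<beta>_def)
    then show ?thesis
      unfolding ultraproduct_eq_Quot
      using ring_hom_zero[OF N.rcos_ring_hom P.ring_axioms N.quotient_is_ring] by simp
  qed
  ultimately show thesis by (rule that)
qed


section \<open>Existentially closed rings\<close>

lemma ring_hom_cring_id: "cring R \<Longrightarrow> ring_hom_cring R R id"
  by (intro ring_hom_cringI2) auto

text \<open>The laws are demanded only where arguments and result all lie in \<open>s\<close>; for
  finite \<open>s\<close> these are finitely many equations. The map \<alpha> is still defined on
  all of \<open>B\<close>, so that it can serve as one coordinate of a family in a product.\<close>

definition partial_ring_hom ::
  "'b set \<Rightarrow> ('b, 'n) ring_scheme \<Rightarrow> ('a, 'm) ring_scheme \<Rightarrow> ('b \<Rightarrow> 'a) \<Rightarrow> bool"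
  where "partial_ring_hom s B A \<alpha> \<longleftrightarrow> \<alpha> \<in> carrier B \<rightarrow> carrier A \<and>
    (\<one>\<^bsub>B\<^esub> \<in> s \<longrightarrow> \<alpha> \<one>\<^bsub>B\<^esub> = \<one>\<^bsub>A\<^esub>) \<and>
    (\<forall>x\<in>s. \<forall>y\<in>s. x \<oplus>\<^bsub>B\<^esub> y \<in> s \<longrightarrow> \<alpha> (x \<oplus>\<^bsub>B\<^esub> y) = \<alpha> x \<oplus>\<^bsub>A\<^esub> \<alpha> y) \<and>
    (\<forall>x\<in>s. \<forall>y\<in>s. x \<otimes>\<^bsub>B\<^esub> y \<in> s \<longrightarrow> \<alpha> (x \<otimes>\<^bsub>B\<^esub> y) = \<alpha> x \<otimes>\<^bsub>A\<^esub> \<alpha> y)"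

text \<open>The partial homomorphism comes from a finite system over \<open>A\<close>: the polynomials in \<open>E\<close>, a
  new variable for each element of \<open>s\<close>, the addition and multiplication table of \<open>s\<close>, and the
  equation that identifies \<open>p\<close> with the variable of its value.\<close>

lemma existentially_closed_partial_hom:
  fixes V :: "nat set"
  assumes ec: "existentially_closed_hom A B f" and hom: "ring_hom_cring A B f"
    and V: "finite V" and E: "finite E" "E \<subseteq> carrier (mpoly_ring A V)"
    and p: "p \<in> carrier (mpoly_ring A V)"
    and vanish: "\<And>a. a \<in> zero_set A A id V E \<Longrightarrow> mpoly_eval A A id a p = \<zero>\<^bsub>A\<^esub>"
    and b: "b \<in> zero_set A B f V E"
    and s: "finite s" "s \<subseteq> carrier B"
  shows "\<exists>\<alpha>. partial_ring_hom s B A \<alpha> \<and>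
    (mpoly_eval A B f b p \<in> s \<longrightarrow> \<alpha> (mpoly_eval A B f b p) = \<zero>\<^bsub>A\<^esub>)"
proof -
  interpret f: ring_hom_cring A B f by fact
  interpret A: ring_hom_cring A A id by (rule ring_hom_cring_id) (rule f.R.cring_axioms)
  \<comment> \<open>The variables are natural numbers, so outside the finite set \<open>V\<close>
    there is a new one for each element of \<open>s\<close>.\<close>
  have "infinite (- V)"
    using V by simp
  then obtain \<iota> where \<iota>: "inj_on \<iota> s" "\<iota> ` s \<subseteq> - V"
    using finite_lepoll_infinite[OF _ s(1)] unfolding lepoll_def by blast
  define W where "W = V \<union> \<iota> ` s"
  define Y where "Y x = f.R.mpoly_var (\<iota> x)" for x
  define c where "c = mpoly_eval A B f b p"
  let ?P = "mpoly_ring A W"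
  interpret P: cring ?P by (rule f.R.mpoly_ring_cring)
  \<comment> \<open>Intersecting \<open>s\<close> with a singleton imposes the equation for the
    unit, or for \<open>c\<close>, only if that element lies in \<open>s\<close> and so has a
    variable.\<close>
  define T where "T = (\<lambda>x. Y x \<ominus>\<^bsub>?P\<^esub> \<one>\<^bsub>?P\<^esub>) ` (s \<inter> {\<one>\<^bsub>B\<^esub>}) \<union> (\<lambda>x. Y x \<ominus>\<^bsub>?P\<^esub> p) ` (s \<inter> {c}) \<union>
    (\<lambda>(x, y). Y (x \<oplus>\<^bsub>B\<^esub> y) \<ominus>\<^bsub>?P\<^esub> (Y x \<oplus>\<^bsub>?P\<^esub> Y y)) ` {(x, y) \<in> s \<times> s. x \<oplus>\<^bsub>B\<^esub> y \<in> s} \<union>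
    (\<lambda>(x, y). Y (x \<otimes>\<^bsub>B\<^esub> y) \<ominus>\<^bsub>?P\<^esub> (Y x \<otimes>\<^bsub>?P\<^esub> Y y)) ` {(x, y) \<in> s \<times> s. x \<otimes>\<^bsub>B\<^esub> y \<in> s}"
  have Y: "Y x \<in> carrier ?P" if "x \<in> s" for x
    unfolding Y_def using that by (intro f.R.mpoly_var_closed) (auto simp: W_def)
  have pW: "p \<in> carrier ?P" and EW: "E \<subseteq> carrier ?P"
    using p E mpoly_carrier_mono[of V W A] by (auto simp: W_def)
  have T: "T \<subseteq> carrier ?P"
    unfolding T_def using Y pW P.one_closed by (auto intro!: P.minus_closed P.a_closed P.m_closed simp del: mpoly_ring_simps)
  have finT: "finite T"
    unfolding T_def using s(1) by (auto intro!: finite_imageI intro: finite_subset[of _ "s \<times> s"])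
  define J where "J = Idl\<^bsub>?P\<^esub> (E \<union> T)"
  have ET: "E \<union> T \<subseteq> carrier ?P"
    using EW T by blast
  have fg: "fg_ideal J ?P"
    unfolding fg_ideal_def J_def using ET finT E(1) by blast
  \<comment> \<open>Stated for an arbitrary homomorphism because it is read twice: in
    \<open>B\<close>, to see that the system is solvable, and in \<open>A\<close>, to extract the
    partial homomorphism from a solution.\<close>
  have T_zero_iff: "(\<forall>q\<in>T. ev q = \<zero>\<^bsub>S\<^esub>) \<longleftrightarrow>
      (\<one>\<^bsub>B\<^esub> \<in> s \<longrightarrow> ev (Y \<one>\<^bsub>B\<^esub>) = \<one>\<^bsub>S\<^esub>) \<and> (c \<in> s \<longrightarrow> ev (Y c) = ev p) \<and>
      (\<forall>x\<in>s. \<forall>y\<in>s. x \<oplus>\<^bsub>B\<^esub> y \<in> s \<longrightarrow> ev (Y (x \<oplus>\<^bsub>B\<^esub> y)) = ev (Y x) \<oplus>\<^bsub>S\<^esub> ev (Y y)) \<and>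
      (\<forall>x\<in>s. \<forall>y\<in>s. x \<otimes>\<^bsub>B\<^esub> y \<in> s \<longrightarrow> ev (Y (x \<otimes>\<^bsub>B\<^esub> y)) = ev (Y x) \<otimes>\<^bsub>S\<^esub> ev (Y y))"
    if "ring_hom_cring ?P S ev" for S :: "('e, 'f) ring_scheme" and ev
  proof -
    interpret ev: ring_hom_cring ?P S ev by (rule that)
    have minus: "ev (q \<ominus>\<^bsub>?P\<^esub> r) = \<zero>\<^bsub>S\<^esub> \<longleftrightarrow> ev q = ev r" if "q \<in> carrier ?P" "r \<in> carrier ?P" for q r
    proof -
      have "ev (q \<ominus>\<^bsub>?P\<^esub> r) = ev q \<ominus>\<^bsub>S\<^esub> ev r"
        using that by (simp add: P.minus_eq ev.S.minus_eq del: mpoly_ring_simps)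
      then show ?thesis
        using that by (simp add: ev.S.r_right_minus_eq)
    qed
    have "(\<forall>q\<in>T. ev q = \<zero>\<^bsub>S\<^esub>) \<longleftrightarrow>
      (\<one>\<^bsub>B\<^esub> \<in> s \<longrightarrow> ev (Y \<one>\<^bsub>B\<^esub> \<ominus>\<^bsub>?P\<^esub> \<one>\<^bsub>?P\<^esub>) = \<zero>\<^bsub>S\<^esub>) \<and> (c \<in> s \<longrightarrow> ev (Y c \<ominus>\<^bsub>?P\<^esub> p) = \<zero>\<^bsub>S\<^esub>) \<and>
      (\<forall>x\<in>s. \<forall>y\<in>s. x \<oplus>\<^bsub>B\<^esub> y \<in> s \<longrightarrow> ev (Y (x \<oplus>\<^bsub>B\<^esub> y) \<ominus>\<^bsub>?P\<^esub> (Y x \<oplus>\<^bsub>?P\<^esub> Y y)) = \<zero>\<^bsub>S\<^esub>) \<and>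
      (\<forall>x\<in>s. \<forall>y\<in>s. x \<otimes>\<^bsub>B\<^esub> y \<in> s \<longrightarrow> ev (Y (x \<otimes>\<^bsub>B\<^esub> y) \<ominus>\<^bsub>?P\<^esub> (Y x \<otimes>\<^bsub>?P\<^esub> Y y)) = \<zero>\<^bsub>S\<^esub>)"
      unfolding T_def ball_Un by (auto simp del: mpoly_ring_simps)
    then show ?thesis
      by (simp add: minus Y pW del: mpoly_ring_simps cong: ball_cong imp_cong)
  qed

  have bV: "b \<in> V \<rightarrow>\<^sub>E carrier B" and bE: "\<And>q. q \<in> E \<Longrightarrow> mpoly_eval A B f b q = \<zero>\<^bsub>B\<^esub>"
    using b by (auto simp: zero_set_def)
  \<comment> \<open>The variable of \<open>x\<close> takes the value \<open>x\<close> itself, so the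
    tables of \<open>B\<close> and the equation for \<open>c\<close> hold at this point.\<close>
  define b' where "b' = (\<lambda>i\<in>W. if i \<in> V then b i else inv_into s \<iota> i)"
  have b'W: "b' \<in> W \<rightarrow>\<^sub>E carrier B"
  proof -
    have "inv_into s \<iota> i \<in> carrier B" if "i \<in> \<iota> ` s" for i
      using inv_into_into[OF that] s(2) by blast
    then show ?thesis
      using bV by (auto simp: b'_def W_def PiE_iff)
  qed
  have hom_b': "ring_hom_cring ?P B (mpoly_eval A B f b')"
    using b'W by (intro f.mpoly_eval_hom) blast
  have ev_b': "mpoly_eval A B f b' q = mpoly_eval A B f b q" if "q \<in> carrier (mpoly_ring A V)" for q
    using that b'W bV unfolding b'_def W_def
    by (intro f.mpoly_eval_cong[where V = V]) (fastforce simp: PiE_iff)+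
  have Y_b': "mpoly_eval A B f b' (Y x) = x" if "x \<in> s" for x
  proof -
    have "b' (\<iota> x) = x"
      using that \<iota> by (auto simp: b'_def W_def)
    then show ?thesis
      unfolding Y_def using that s(2) by (subst f.mpoly_eval_var) auto
  qed
  have "b' \<in> zero_set A B f W (E \<union> T)"
  proof -
    have "\<forall>q\<in>T. mpoly_eval A B f b' q = \<zero>\<^bsub>B\<^esub>"
      unfolding T_zero_iff[OF hom_b'] using Y_b' ev_b'[OF p] by (auto simp: c_def)
    then show ?thesis
      using b'W bE ev_b' E(2) by (auto simp: zero_set_def)
  qed
  then have "zero_set A B f W J \<noteq> {}"
    unfolding J_def f.zero_set_genideal[OF ET] by blast
  then have "zero_set A A id W J \<noteq> {}"
    using ec fg V s(1) unfolding existentially_closed_hom_def by (auto simp: W_def)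
  then obtain a where "a \<in> zero_set A A id W (E \<union> T)"
    unfolding J_def A.zero_set_genideal[OF ET] by blast
  then have aW: "a \<in> W \<rightarrow>\<^sub>E carrier A"
    and aE: "\<And>q. q \<in> E \<Longrightarrow> mpoly_eval A A id a q = \<zero>\<^bsub>A\<^esub>"
    and aT: "\<forall>q\<in>T. mpoly_eval A A id a q = \<zero>\<^bsub>A\<^esub>"
    by (auto simp: zero_set_def)
  have hom_a: "ring_hom_cring ?P A (mpoly_eval A A id a)"
    using aW by (intro A.mpoly_eval_hom) blast
  have ev_a: "mpoly_eval A A id (restrict a V) q = mpoly_eval A A id a q"
    if "q \<in> carrier (mpoly_ring A V)" for q
    using that aW by (intro A.mpoly_eval_cong[where V = V]) (auto simp: W_def PiE_iff)
  \<comment> \<open>The hypothesis on \<open>p\<close> concerns zeros in \<open>A\<close>, and here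
    is one. It turns the equation for \<open>c\<close> into the vanishing of the variable of
    \<open>c\<close>.\<close>
  have "restrict a V \<in> zero_set A A id V E"
    using aW aE ev_a E(2) by (auto simp: zero_set_def W_def PiE_iff)
  then have p0: "mpoly_eval A A id a p = \<zero>\<^bsub>A\<^esub>"
    using vanish ev_a[OF p] by metis
  have Y_a: "mpoly_eval A A id a (Y x) = a (\<iota> x)" if "x \<in> s" for x
    unfolding Y_def using that aW by (intro A.mpoly_eval_var) (auto simp: W_def PiE_iff)
  \<comment> \<open>Outside \<open>s\<close> any value in \<open>A\<close> would do; zero is
    chosen.\<close>
  define \<alpha> where "\<alpha> x = (if x \<in> s then a (\<iota> x) else \<zero>\<^bsub>A\<^esub>)" for x
  note eqs = aT[unfolded T_zero_iff[OF hom_a] p0]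
  have "\<alpha> \<in> carrier B \<rightarrow> carrier A"
    using aW by (auto simp: \<alpha>_def W_def PiE_iff)
  then have "partial_ring_hom s B A \<alpha>"
    using eqs Y_a unfolding partial_ring_hom_def by (simp add: \<alpha>_def)
  moreover have "c \<in> s \<longrightarrow> \<alpha> c = \<zero>\<^bsub>A\<^esub>"
    using eqs Y_a by (simp add: \<alpha>_def)
  ultimately show ?thesis
    unfolding c_def by blast
qed

text \<open>Read \<open>c\<close> as a constant polynomial in no variables. The only point of the
  empty power is a zero of it exactly when its value is zero, so solvability in \<open>B\<close>
  forces \<open>c\<close> to vanish in \<open>A\<close>.\<close>

lemma existentially_closed_hom_trivial_kernel:
  assumes "existentially_closed_hom A B f" "ring_hom_cring A B f"
    and "c \<in> carrier A" "f c = \<zero>\<^bsub>B\<^esub>"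
  shows "c = \<zero>\<^bsub>A\<^esub>"
proof -
  interpret f: ring_hom_cring A B f by fact
  interpret A: ring_hom_cring A A id by (rule ring_hom_cring_id) (rule f.R.cring_axioms)
  let ?E = "{f.R.mpoly_monom c ({#} :: nat multiset)}" and ?P = "mpoly_ring A ({} :: nat set)"
  have E: "?E \<subseteq> carrier ?P"
    using assms(3) by (simp add: f.R.mpoly_monom_closed)
  have "(\<lambda>_. undefined) \<in> zero_set A B f {} ?E"
    using assms(3,4) by (auto simp: zero_set_def f.mpoly_eval_const)
  then have "zero_set A B f {} (Idl\<^bsub>?P\<^esub> ?E) \<noteq> {}"
    unfolding f.zero_set_genideal[OF E] by blast
  moreover have "fg_ideal (Idl\<^bsub>?P\<^esub> ?E) ?P"
    unfolding fg_ideal_def using E by blast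
  ultimately have "zero_set A A id {} (Idl\<^bsub>?P\<^esub> ?E) \<noteq> {}"
    using assms(1) unfolding existentially_closed_hom_def by blast
  then obtain a where "a \<in> zero_set A A id {} ?E"
    unfolding A.zero_set_genideal[OF E] by blast
  then show ?thesis
    using assms(3) by (auto simp: zero_set_def A.mpoly_eval_const)
qed

lemma ultraproduct_ring:
  assumes "\<And>i. i \<in> I \<Longrightarrow> ring (R i)" "\<forall>\<^sub>F i in U. i \<in> I"
  shows "ring (ultraproduct I U R)"
  unfolding ultraproduct_eq_Quot by (rule ideal.quotient_is_ring) (rule null_ideal_ideal[OF assms])

text \<open>As \<open>B\<close> is existentially closed in \<open>C\<close>, every homomorphism from
  \<open>B\<close> to a ring of \<open>C\<close> has trivial kernel. It suffices that one of them
  kills \<open>c\<close>, and an isomorphic copy of an ultrapower of \<open>A\<close> receives such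
  a homomorphism.\<close>

lemma zero_of_partial_homs:
  fixes C :: "'u ring set"
  assumes C: "full_subcategory C" "closed_under_ultraproducts C"
    and A: "A \<in> C" and B: "B \<in> ec_subcategory C" and c: "c \<in> carrier B"
    and partial: "\<And>s. finite s \<Longrightarrow> s \<subseteq> carrier B \<Longrightarrow>
      \<exists>\<alpha>. partial_ring_hom s B A \<alpha> \<and> (c \<in> s \<longrightarrow> \<alpha> c = \<zero>\<^bsub>A\<^esub>)"
  shows "c = \<zero>\<^bsub>B\<^esub>"
proof -
  have BC: "B \<in> C" and ec: "\<And>S g. S \<in> C \<Longrightarrow> g \<in> ring_hom B S \<Longrightarrow> existentially_closed_hom B S g"
    using B by (auto simp: ec_subcategory_def existentially_closed_in_def)
  have cr: "cring S" if "S \<in> C" for S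
    using C(1) that by (auto simp: full_subcategory_def)
  \<comment> \<open>The carrier of \<open>B\<close> is the index set of the ultrapower, so it has to
    be small.\<close>
  have small: "carrier B \<prec> (UNIV :: 'u set)"
    using C(1) BC by (auto simp: full_subcategory_def)
  interpret A: cring A using A by (rule cr)
  interpret B: cring B using BC by (rule cr)
  have "carrier B \<noteq> {}"
    using c by blast
  then obtain e where e: "\<And>i. i \<in> carrier B \<Longrightarrow> finite (e i) \<and> e i \<subseteq> carrier B"
    "\<And>t. finite t \<Longrightarrow> t \<subseteq> carrier B \<Longrightarrow> \<exists>i\<in>carrier B. t \<subseteq> e i"
    by (rule cofinal_finite_subsets) blast
  obtain U where U: "ultrafilter_on (carrier B) U"
    "\<And>t. finite t \<Longrightarrow> t \<subseteq> carrier B \<Longrightarrow> \<forall>\<^sub>F i in U. t \<subseteq> e i"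
    using cofinal_ultrafilter[OF e(2)] by blast
  have UI: "\<forall>\<^sub>F i in U. i \<in> carrier B"
    using U(1) by (simp add: ultrafilter_on_def)
  have "\<forall>i\<in>carrier B. \<exists>\<alpha>. partial_ring_hom (e i) B A \<alpha> \<and> (c \<in> e i \<longrightarrow> \<alpha> c = \<zero>\<^bsub>A\<^esub>)"
    using partial e(1) by simp
  from bchoice[OF this] obtain \<alpha> where \<alpha>: "\<And>i. i \<in> carrier B \<Longrightarrow> partial_ring_hom (e i) B A (\<alpha> i)"
    and \<alpha>_c: "\<And>i. i \<in> carrier B \<Longrightarrow> c \<in> e i \<Longrightarrow> \<alpha> i c = \<zero>\<^bsub>A\<^esub>"
    by blast
  note \<alpha> = \<alpha>[unfolded partial_ring_hom_def]
  let ?S = "ultraproduct (carrier B) U (\<lambda>_. A)"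
  \<comment> \<open>Applied below to the arguments and the result of one operation at a time: almost
    every \<open>e i\<close> contains them all, and there \<alpha> respects the operation.\<close>
  have ev: "\<forall>\<^sub>F i in U. i \<in> carrier B \<and> t \<subseteq> e i" if "finite t" "t \<subseteq> carrier B" for t
    using eventually_conj[OF UI U(2)[OF that]] .
  obtain h where h: "h \<in> ring_hom B ?S"
    "\<And>x. x \<in> carrier B \<Longrightarrow> \<forall>\<^sub>F i in U. \<alpha> i x = \<zero>\<^bsub>A\<^esub> \<Longrightarrow> h x = \<zero>\<^bsub>?S\<^esub>"
  proof (rule ultraproduct_hom[of "carrier B" "\<lambda>_. A" U B \<alpha>])
    show "\<alpha> i x \<in> carrier A" if "i \<in> carrier B" "x \<in> carrier B" for i x
      using \<alpha> that by blast
    show "\<forall>\<^sub>F i in U. \<alpha> i (x \<oplus>\<^bsub>B\<^esub> y) = \<alpha> i x \<oplus>\<^bsub>A\<^esub> \<alpha> i y" if "x \<in> carrier B" "y \<in> carrier B" for x y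
      using ev[of "{x, y, x \<oplus>\<^bsub>B\<^esub> y}"] that by (auto elim!: eventually_mono simp: \<alpha>)
    show "\<forall>\<^sub>F i in U. \<alpha> i (x \<otimes>\<^bsub>B\<^esub> y) = \<alpha> i x \<otimes>\<^bsub>A\<^esub> \<alpha> i y" if "x \<in> carrier B" "y \<in> carrier B" for x y
      using ev[of "{x, y, x \<otimes>\<^bsub>B\<^esub> y}"] that by (auto elim!: eventually_mono simp: \<alpha>)
    show "\<forall>\<^sub>F i in U. \<alpha> i \<one>\<^bsub>B\<^esub> = \<one>\<^bsub>A\<^esub>"
      using ev[of "{\<one>\<^bsub>B\<^esub>}"] by (auto elim!: eventually_mono simp: \<alpha>)
  qed (use UI A.ring_axioms B.ring_axioms in auto)
  have "h c = \<zero>\<^bsub>?S\<^esub>"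
    using ev[of "{c}"] c by (intro h(2)) (auto elim!: eventually_mono intro: \<alpha>_c)
  moreover have "\<exists>S\<in>C. ?S \<simeq> S"
    using C(2)[unfolded closed_under_ultraproducts_def, rule_format, of "carrier B" U "\<lambda>_. A"]
      small U(1) A by simp
  then obtain S where S: "S \<in> C" "?S \<simeq> S" by blast
  then obtain \<phi> where \<phi>: "\<phi> \<in> ring_iso ?S S"
    by (auto simp: is_ring_iso_def)
  then have \<phi>_hom: "\<phi> \<in> ring_hom ?S S"
    by (simp add: ring_iso_def)
  have "\<phi> \<zero>\<^bsub>?S\<^esub> = \<zero>\<^bsub>S\<^esub>"
    by (rule ring_hom_zero[OF \<phi>_hom])
      (use S(1) cr in \<open>auto intro!: ultraproduct_ring UI A.ring_axioms simp: cring_def\<close>)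
  ultimately have "(\<phi> \<circ> h) c = \<zero>\<^bsub>S\<^esub>"
    by simp
  moreover have hom: "\<phi> \<circ> h \<in> ring_hom B S"
    by (rule ring_hom_trans[OF h(1) \<phi>_hom])
  ultimately show ?thesis
    using c S(1) BC cr ec
    by (intro existentially_closed_hom_trivial_kernel[of B S "\<phi> \<circ> h"] ring_hom_cringI2) auto
qed

section \<open>Prime ideals relative to a subcategory as kernels of evaluations\<close>

lemma prime_wrt_kernel:
  assumes "ring_hom_ring R S h" "S \<in> D"
  shows "prime_wrt D (a_kernel R S h) R"
proof -
  interpret ring_hom_ring R S h by fact
  \<comment> \<open>The first isomorphism theorem: the induced map sends a coset to the common value
    of \<open>h\<close> on it.\<close>
  have "inj_on (\<lambda>Z. the_elem (h ` Z)) (carrier (R Quot a_kernel R S h))"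
    using the_elem_inj by (intro inj_onI)
  then show ?thesis
    unfolding prime_wrt_def using kernel_is_ideal the_elem_hom assms(2) by blast
qed

text \<open>The quotient map followed by the embedding is a homomorphism out of the polynomial ring,
  hence the evaluation at a point. As the embedding is injective, its kernel is exactly
  \<open>P\<close>.\<close>

lemma prime_wrt_point:
  fixes A :: "'u ring" and V :: "'v set"
  assumes A: "cring A" and D: "\<And>S. S \<in> D \<Longrightarrow> cring S" and P: "prime_wrt D P (mpoly_ring A V)"
  obtains S f b where "S \<in> D" "ring_hom_cring A S f" "b \<in> V \<rightarrow>\<^sub>E carrier S"
    "\<And>p. p \<in> carrier (mpoly_ring A V) \<Longrightarrow> mpoly_eval A S f b p = \<zero>\<^bsub>S\<^esub> \<longleftrightarrow> p \<in> P"
proof -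
  interpret A: cring A by fact
  let ?R = "mpoly_ring A V"
  interpret R: cring ?R by (rule A.mpoly_ring_cring)
  obtain S h where S: "S \<in> D" and h: "h \<in> ring_hom (?R Quot P) S" "inj_on h (carrier (?R Quot P))"
    and "ideal P ?R"
    using P by (auto simp: prime_wrt_def)
  interpret P: ideal P ?R by fact
  interpret S: cring S using S by (rule D)
  define \<phi> where "\<phi> = h \<circ> (+>\<^bsub>?R\<^esub>) P"
  have hom: "ring_hom_cring ?R S \<phi>"
    unfolding \<phi>_def
    by (intro ring_hom_cringI2 ring_hom_trans[OF P.rcos_ring_hom h(1)] R.cring_axioms S.cring_axioms)
  interpret \<phi>: ring_hom_cring ?R S \<phi> by (rule hom)
  have h0: "h \<zero>\<^bsub>?R Quot P\<^esub> = \<zero>\<^bsub>S\<^esub>"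
    by (rule ring_hom_zero[OF h(1) P.quotient_is_ring S.ring_axioms])
  have zero_iff: "\<phi> p = \<zero>\<^bsub>S\<^esub> \<longleftrightarrow> p \<in> P" if p: "p \<in> carrier ?R" for p
  proof -
    have "P +>\<^bsub>?R\<^esub> p \<in> carrier (?R Quot P)" "\<zero>\<^bsub>?R Quot P\<^esub> \<in> carrier (?R Quot P)"
      using ring_hom_closed[OF P.rcos_ring_hom p] ring.ring_simprules(2)[OF P.quotient_is_ring] .
    then have "\<phi> p = \<zero>\<^bsub>S\<^esub> \<longleftrightarrow> P +>\<^bsub>?R\<^esub> p = \<zero>\<^bsub>?R Quot P\<^esub>"
      unfolding \<phi>_def o_def h0[symmetric] by (rule inj_on_eq_iff[OF h(2)])
    also have "\<dots> \<longleftrightarrow> P +>\<^bsub>?R\<^esub> p = P"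
      by (simp add: FactRing_def)
    also have "\<dots> \<longleftrightarrow> p \<in> P"
      using P.rcos_const_imp_mem[OF p] P.a_rcos_const by blast
    finally show ?thesis .
  qed
  show thesis
  proof (rule that)
    show "S \<in> D" by (rule S)
    show "ring_hom_cring A S (\<lambda>a. \<phi> (A.mpoly_monom a {#}))"
      using ring_hom_cring_comp[OF A.mpoly_const_hom hom] by (simp add: o_def)
    show "(\<lambda>v\<in>V. \<phi> (A.mpoly_var v)) \<in> V \<rightarrow>\<^sub>E carrier S"
      by (auto intro: \<phi>.hom_closed)
    show "mpoly_eval A S (\<lambda>a. \<phi> (A.mpoly_monom a {#})) (\<lambda>v\<in>V. \<phi> (A.mpoly_var v)) p = \<zero>\<^bsub>S\<^esub> \<longleftrightarrow> p \<in> P"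
      if "p \<in> carrier ?R" for p
      using zero_iff[OF that] A.mpoly_hom_eq_eval[OF hom that] by simp
  qed
qed

theorem theorem2p6:
  fixes C :: "'u ring set"
  assumes "full_subcategory C"
    and "closed_under_ultraproducts C"
  shows "\<forall>A\<in>ec_subcategory C. geometrically_closed_in (ec_subcategory C) A"
  unfolding geometrically_closed_in_def
proof (intro ballI conjI allI impI)
  fix A V I
  assume A: "A \<in> ec_subcategory C" and V: "finite (V :: nat set)" and I: "fg_ideal I (mpoly_ring A V)"
  have cr: "cring S" if "S \<in> ec_subcategory C" for S
    using assms(1) that by (auto simp: full_subcategory_def ec_subcategory_def existentially_closed_in_def)
  interpret A: ring_hom_cring A A id
    by (rule ring_hom_cring_id) (rule cr[OF A])
  interpret P: cring "mpoly_ring A V" by (rule A.R.mpoly_ring_cring)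
  obtain E where E: "finite E" "E \<subseteq> carrier (mpoly_ring A V)" "I = Idl\<^bsub>mpoly_ring A V\<^esub> E"
    using I by (auto simp: fg_ideal_def)
  have I_carrier: "I \<subseteq> carrier (mpoly_ring A V)"
    unfolding E(3) using P.genideal_ideal[OF E(2)] by (rule ideal.Icarr[THEN subsetI])
  have EI: "E \<subseteq> I"
    unfolding E(3) by (rule P.genideal_self[OF E(2)])
  show "vanishing_ideal A V (zero_set A A id V I) = radical_wrt (ec_subcategory C) I (mpoly_ring A V)"
  proof (intro equalityI subsetI)
    fix p assume "p \<in> vanishing_ideal A V (zero_set A A id V I)"
    then have p: "p \<in> carrier (mpoly_ring A V)"
      and vanish: "\<And>a. a \<in> zero_set A A id V E \<Longrightarrow> mpoly_eval A A id a p = \<zero>\<^bsub>A\<^esub>"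
      unfolding E(3) A.zero_set_genideal[OF E(2)] by (auto simp: vanishing_ideal_def)
    \<comment> \<open>Membership in the radical is tested at one prime \<open>Q\<close>, which
      consists of the polynomials that vanish at a point \<open>b\<close> over some \<open>B\<close>
      in \<open>C\<^sup>+\<close>.\<close>
    have "p \<in> Q" if Q: "prime_wrt (ec_subcategory C) Q (mpoly_ring A V)" "I \<subseteq> Q" for Q
    proof -
      obtain B f b where B: "B \<in> ec_subcategory C" and f: "ring_hom_cring A B f"
        and b: "b \<in> V \<rightarrow>\<^sub>E carrier B"
        and Q_iff: "\<And>q. q \<in> carrier (mpoly_ring A V) \<Longrightarrow> mpoly_eval A B f b q = \<zero>\<^bsub>B\<^esub> \<longleftrightarrow> q \<in> Q"
        by (rule prime_wrt_point[OF cr[OF A] cr Q(1)]) blast+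
      \<comment> \<open>This is existential closedness of \<open>A\<close>, since \<open>B\<close>
        lies in \<open>C\<close>; that of \<open>B\<close> enters through
        \<open>zero_of_partial_homs\<close>.\<close>
      have "existentially_closed_hom A B f"
        using A B ring_hom_cring.homh[OF f]
        by (auto simp: ec_subcategory_def existentially_closed_in_def)
      moreover have "b \<in> zero_set A B f V E"
        using b E(2) EI Q(2) Q_iff unfolding zero_set_def by blast
      ultimately have partial: "\<exists>\<alpha>. partial_ring_hom s B A \<alpha> \<and>
          (mpoly_eval A B f b p \<in> s \<longrightarrow> \<alpha> (mpoly_eval A B f b p) = \<zero>\<^bsub>A\<^esub>)"
        if "finite s" "s \<subseteq> carrier B" for s
        by (intro existentially_closed_partial_hom[OF _ f V E(1,2) p vanish _ that])
      have "mpoly_eval A B f b p \<in> carrier B"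
        using b by (intro ring_hom_cring.mpoly_eval_closed[OF f p]) blast
      then have "mpoly_eval A B f b p = \<zero>\<^bsub>B\<^esub>"
        using A B partial
        by (intro zero_of_partial_homs[OF assms, of A B])
          (auto simp: ec_subcategory_def existentially_closed_in_def)
      then show ?thesis
        using Q_iff[OF p] by blast
    qed
    with p show "p \<in> radical_wrt (ec_subcategory C) I (mpoly_ring A V)"
      by (auto simp: radical_wrt_def)
  next
    fix p assume p: "p \<in> radical_wrt (ec_subcategory C) I (mpoly_ring A V)"
    have "mpoly_eval A A id a p = \<zero>\<^bsub>A\<^esub>" if a: "a \<in> zero_set A A id V I" for a
    proof -
      \<comment> \<open>The quotient by this kernel embeds into \<open>A\<close>, itself a ring of
        \<open>C\<^sup>+\<close>. So the kernel is one of the primes above \<open>I\<close> whose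
        intersection contains \<open>p\<close>.\<close>
      let ?K = "a_kernel (mpoly_ring A V) A (mpoly_eval A A id a)"
      have "a \<in> V \<rightarrow> carrier A"
        using a by (auto simp: zero_set_def)
      then have "mpoly_eval A A id a \<in> ring_hom (mpoly_ring A V) A"
        by (rule A.mpoly_eval_hom[THEN ring_hom_cring.homh])
      then have "ring_hom_ring (mpoly_ring A V) A (mpoly_eval A A id a)"
        by (intro ring_hom_ringI2 P.ring_axioms cring.axioms(1)[OF cr[OF A]])
      then have "prime_wrt (ec_subcategory C) ?K (mpoly_ring A V)"
        using A by (rule prime_wrt_kernel)
      moreover have "I \<subseteq> ?K"
        using a I_carrier by (auto simp: zero_set_def a_kernel_def')
      ultimately have "p \<in> ?K"
        using p by (auto simp: radical_wrt_def)
      then show ?thesis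
        by (simp add: a_kernel_def')
    qed
    with p show "p \<in> vanishing_ideal A V (zero_set A A id V I)"
      by (auto simp: vanishing_ideal_def radical_wrt_def)
  qed
qed

end
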